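(* A bi-coloured multigraph $G$ is $(2,2)$-tight and $(2,3)$-limited if and only if $G$ can be generated from $K_1$ by a finite sequence of $K_2\sqcup K_2$ substitutions, $0$-extensions, and $1$-extensions which are not of the colour case $r\to\{b,b\}$ or the parallel edge colour case $b\to\{r,r\}$.
   Context: A bi-coloured multigraph is a finite loopless multigraph with nonempty vertex set, each of whose edges is coloured blue ($b$) or red ($r$), with no two parallel edges of the same colour. All graphs in a generating sequence are bi-coloured multigraphs. $(vw,c)$ denotes an edge $vw$ of colour $c$. For $k\in\{2,3\}$, a multigraph is $(2,k)$-sparse if $|E'|\le 2|V'|-k$ for all subgraphs $(V',E')$ with $|E'|>0$ (parallel edges counted with multiplicity), and $(2,k)$-tight if moreover $|E|=2|V|-k$. A bi-coloured multigraph is $(2,3)$-limited if every subgraph all of whose edges are blue is $(2,3)$-sparse. Moves: - $0$-extension: add a new vertex $v$ and two edges incident to $v$; either $v$ has two distinct neighbours (arbitrary colours) or one neighbour (one edge of each colour). - $1$-extension: delete an edge $xy$ and add a new vertex $v$ of degree $3$, with two replacement edges $xv$, $yv$ and a third (connecting) edge $vz$ of arbitrary colour, where $z$ is a vertex of the graph; $z\in\{x,y\}$ is allowed provided the two resulting parallel edges have distinct colours. The move is of colour case $c_1\to\{c_2,c_3\}$ if the deleted edge $xy$ has colour $c_1$ and the replacement edges $xv,yv$ have colours $c_2,c_3$ (in some order). It is of the parallel edge colour case $b\to\{r,r\}$ if it is of colour case $b\to\{r,r\}$ and the deleted blue edge $(xy,b)$ has a parallel red edge $(xy,r)$ in the graph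 to which the move is applied. - $K_2\sqcup K_2$ substitution: choose three distinct vertices $x,y,z$ such that all of $(xy,b),(xy,r),(yz,b),(yz,r)$ are edges; delete these four edges, add a new vertex $v$, and add the six red edges of the complete graph on $\{x,y,z,v\}$. *)

theory Defs
  imports Main
begin

datatype colour = Blue | Red

text \<open>The edge \<open>(vw,c)\<close> is encoded as \<open>({v, w}, c)\<close>. Parallel edges of a bi-coloured multigraph
  have different colours, so a set of such pairs carries the multiplicities, and its cardinality
  counts parallel edges separately.\<close>

record 'a bcgraph =
  verts :: "'a set"
  edges :: "('a set \<times> colour) set"

definition bicoloured_multigraph :: "'a bcgraph \<Rightarrow> bool" where
  "bicoloured_multigraph G \<longleftrightarrow>
     finite (verts G) \<and> verts G \<noteq> {} \<and>
     (\<forall>(e, c) \<in> edges G. \<exists>v \<in> verts G. \<exists>w \<in> verts G. v \<noteq> w \<and> e = {v, w})"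

definition subgraph :: "'a bcgraph \<Rightarrow> 'a bcgraph \<Rightarrow> bool" where
  "subgraph H G \<longleftrightarrow>
     bicoloured_multigraph H \<and> verts H \<subseteq> verts G \<and> edges H \<subseteq> edges G"

definition sparse :: "nat \<Rightarrow> 'a bcgraph \<Rightarrow> bool" where
  "sparse k G \<longleftrightarrow>
     (\<forall>H. subgraph H G \<and> card (edges H) > 0 \<longrightarrow>
        int (card (edges H)) \<le> 2 * int (card (verts H)) - int k)"

definition tight :: "nat \<Rightarrow> 'a bcgraph \<Rightarrow> bool" where
  "tight k G \<longleftrightarrow>
     sparse k G \<and> int (card (edges G)) = 2 * int (card (verts G)) - int k"

definition limited :: "'a bcgraph \<Rightarrow> bool" where
  "limited G \<longleftrightarrow>
     (\<forall>H. subgraph H G \<and> (\<forall>(e, c) \<in> edges H. c = Blue) \<longrightarrow> sparse 3 H)"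

definition K1 :: "'a \<Rightarrow> 'a bcgraph" where
  "K1 u = \<lparr>verts = {u}, edges = {}\<rparr>"

definition zero_extension :: "'a bcgraph \<Rightarrow> 'a bcgraph \<Rightarrow> bool" where
  "zero_extension G G' \<longleftrightarrow>
     bicoloured_multigraph G \<and>
     (\<exists>v x y c d. v \<notin> verts G \<and> x \<in> verts G \<and> y \<in> verts G \<and> (x = y \<longrightarrow> c \<noteq> d) \<and>
        G' = \<lparr>verts = insert v (verts G),
              edges = edges G \<union> {({v, x}, c), ({v, y}, d)}\<rparr>)"

text \<open>\<open>one_extension G x y c1 v c2 c3 z c G'\<close>: the edge \<open>(xy,c1)\<close> is replaced by \<open>(xv,c2)\<close> and
  \<open>(yv,c3)\<close>, and the connecting edge is \<open>(vz,c)\<close>.\<close>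

definition one_extension ::
  "'a bcgraph \<Rightarrow> 'a \<Rightarrow> 'a \<Rightarrow> colour \<Rightarrow> 'a \<Rightarrow> colour \<Rightarrow> colour \<Rightarrow> 'a \<Rightarrow> colour \<Rightarrow> 'a bcgraph \<Rightarrow> bool"
  where
  "one_extension G x y c1 v c2 c3 z c G' \<longleftrightarrow>
     bicoloured_multigraph G \<and>
     ({x, y}, c1) \<in> edges G \<and> v \<notin> verts G \<and> z \<in> verts G \<and>
     (z = x \<longrightarrow> c \<noteq> c2) \<and> (z = y \<longrightarrow> c \<noteq> c3) \<and>
     G' = \<lparr>verts = insert v (verts G),
           edges = (edges G - {({x, y}, c1)}) \<union> {({x, v}, c2), ({y, v}, c3), ({v, z}, c)}\<rparr>"

definition colour_case_r_bb :: "colour \<Rightarrow> colour \<Rightarrow> colour \<Rightarrow> bool" where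
  "colour_case_r_bb c1 c2 c3 \<longleftrightarrow> c1 = Red \<and> c2 = Blue \<and> c3 = Blue"

definition colour_case_b_rr :: "colour \<Rightarrow> colour \<Rightarrow> colour \<Rightarrow> bool" where
  "colour_case_b_rr c1 c2 c3 \<longleftrightarrow> c1 = Blue \<and> c2 = Red \<and> c3 = Red"

definition parallel_colour_case_b_rr ::
  "'a bcgraph \<Rightarrow> 'a \<Rightarrow> 'a \<Rightarrow> colour \<Rightarrow> colour \<Rightarrow> colour \<Rightarrow> bool" where
  "parallel_colour_case_b_rr G x y c1 c2 c3 \<longleftrightarrow>
     colour_case_b_rr c1 c2 c3 \<and> ({x, y}, Red) \<in> edges G"

definition permitted_one_extension :: "'a bcgraph \<Rightarrow> 'a bcgraph \<Rightarrow> bool" where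
  "permitted_one_extension G G' \<longleftrightarrow>
     (\<exists>x y c1 v c2 c3 z c. one_extension G x y c1 v c2 c3 z c G' \<and>
        \<not> colour_case_r_bb c1 c2 c3 \<and> \<not> parallel_colour_case_b_rr G x y c1 c2 c3)"

text \<open>The condition \<open>(xz,r) \<notin> E\<close> below expresses that the result is again a bi-coloured
  multigraph: otherwise the added red edge \<open>xz\<close> would be parallel to an existing red edge, which
  the encoding of edges by a set would silently merge with it.\<close>

definition K2K2_substitution :: "'a bcgraph \<Rightarrow> 'a bcgraph \<Rightarrow> bool" where
  "K2K2_substitution G G' \<longleftrightarrow>
     bicoloured_multigraph G \<and>
     (\<exists>x y z v. distinct [x, y, z] \<and> {x, y, z} \<subseteq> verts G \<and> v \<notin> verts G \<and>
        {({x, y}, Blue), ({x, y}, Red), ({y, z}, Blue), ({y, z}, Red)} \<subseteq> edges G \<and>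
        ({x, z}, Red) \<notin> edges G \<and>
        G' = \<lparr>verts = insert v (verts G),
              edges = (edges G - {({x, y}, Blue), ({x, y}, Red), ({y, z}, Blue), ({y, z}, Red)})
                \<union> {({x, y}, Red), ({x, z}, Red), ({y, z}, Red),
                   ({x, v}, Red), ({y, v}, Red), ({z, v}, Red)}\<rparr>)"

definition permitted_move :: "'a bcgraph \<Rightarrow> 'a bcgraph \<Rightarrow> bool" where
  "permitted_move G G' \<longleftrightarrow>
     K2K2_substitution G G' \<or> zero_extension G G' \<or> permitted_one_extension G G'"

text \<open>Moves keep the names of the old vertices and name the new vertex arbitrarily, so starting
  from \<open>K\<^sub>1\<close> on an arbitrary vertex \<open>u\<close> accounts for generation up to isomorphism.\<close>

definition generated_from_K1 :: "'a bcgraph \<Rightarrow> bool" where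
  "generated_from_K1 G \<longleftrightarrow> (\<exists>u. permitted_move\<^sup>*\<^sup>* (K1 u) G)"

end

theory Submission
  imports Defs
begin

text \<open>A tight graph with at least two vertices has a vertex \<open>v\<close> of degree 2 or 3, and a move can be
  undone at any such vertex. Degree 2 is immediate. In degree 3, no tight set avoiding \<open>v\<close>
  contains all neighbours, and tight sets that meet have a tight union, so at most one pair of
  neighbours is blocked by a tight set. If the edges at an unblocked pair \<open>p, q\<close> have different
  colours, a red or a blue edge \<open>pq\<close> can be restored. If all three edges at \<open>v\<close> are blue, counting
  edges in the union of three blocking sets shows that some blue edge can be restored. If all three
  are red, then either some red edge can be restored or \<open>v\<close> and its neighbours span a red
  \<open>K\<^sub>4\<close>; then a \<open>K\<^sub>2 \<squnion> K\<^sub>2\<close> substitution can be undone, as every set through two of the three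
  neighbours has enough slack for the new blue edges.\<close>

section \<open>Counting form of sparsity\<close>

text \<open>The two excluded colour cases act in opposite directions. Case \<open>r\<close> to
  \<open>{b,b}\<close> can put three blue edges at a new vertex without deleting a blue one, which
  may break limitedness. Its exclusion means that two blue edges at \<open>v\<close> can only be
  merged back into a blue edge, so sets with the maximal blue count 2|W| - 3 obstruct as well as
  tight sets. The parallel case \<open>b\<close> to \<open>{r,r}\<close> shapes the converse: if
  \<open>v\<close> has only red edges and its neighbours span a red triangle, any edge to be
  restored would be blue and parallel to a red one. The substitution exists for this configuration.

  The hard case is three blue edges. Tight sets uncross as soon as they share one vertex, because a
  single vertex already meets the bound 2|W| - 2. It violates 2|W| - 3, so blue-tight sets uncross
  only if they share two vertices. Blocking sets meeting in single vertices can therefore not be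
  merged in pairs, and three of them have to be counted together.\<close>

definition ind :: "('a set \<times> colour) set \<Rightarrow> 'a set \<Rightarrow> ('a set \<times> colour) set" where
  "ind E W = {p \<in> E. fst p \<subseteq> W}"

definition blues :: "('a set \<times> colour) set \<Rightarrow> ('a set \<times> colour) set" where
  "blues E = {p \<in> E. snd p = Blue}"

definition edges_on :: "'a set \<Rightarrow> ('a set \<times> colour) set \<Rightarrow> bool" where
  "edges_on V E \<longleftrightarrow> (\<forall>p \<in> E. \<exists>u \<in> V. \<exists>w \<in> V. u \<noteq> w \<and> fst p = {u, w})"

text \<open>Only vertex sets are quantified, since the induced subgraph has the most edges on a
  given vertex set. The premise on \<open>ind E W\<close> is essential: the empty set violates the
  bound for k = 2 and k = 3, and a single vertex violates it for k = 3.\<close>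

definition ksparse :: "nat \<Rightarrow> 'a set \<Rightarrow> ('a set \<times> colour) set \<Rightarrow> bool" where
  "ksparse k V E \<longleftrightarrow> (\<forall>W \<subseteq> V. ind E W \<noteq> {} \<longrightarrow> card (ind E W) + k \<le> 2 * card W)"

lemma bicoloured_multigraph_alt:
  "bicoloured_multigraph G \<longleftrightarrow> finite (verts G) \<and> verts G \<noteq> {} \<and> edges_on (verts G) (edges G)"
  unfolding bicoloured_multigraph_def edges_on_def by (simp add: case_prod_beta)

lemma edges_on_mono: "edges_on V E \<Longrightarrow> V \<subseteq> V' \<Longrightarrow> E' \<subseteq> E \<Longrightarrow> edges_on V' E'"
  unfolding edges_on_def by (meson subsetD)

lemma edges_on_subset: "edges_on V E \<Longrightarrow> p \<in> E \<Longrightarrow> fst p \<subseteq> V"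
  unfolding edges_on_def by (auto dest!: bspec)

lemma edges_on_Un: "edges_on V (E \<union> F) \<longleftrightarrow> edges_on V E \<and> edges_on V F"
  unfolding edges_on_def by (rule ball_Un)

lemma edges_on_insertI:
  "a \<in> V \<Longrightarrow> b \<in> V \<Longrightarrow> a \<noteq> b \<Longrightarrow> edges_on V E \<Longrightarrow> edges_on V (insert ({a, b}, c) E)"
  unfolding edges_on_def ball_simps by (intro conjI bexI[of _ a] bexI[of _ b]) simp_all

lemma edges_on_empty [simp]: "edges_on V {}"
  unfolding edges_on_def by simp

lemma edges_on_ends:
  assumes "edges_on V E" "({x, y}, c) \<in> E"
  shows "x \<in> V" "y \<in> V" "x \<noteq> y"
proof -
  obtain u w where "u \<in> V" "w \<in> V" "u \<noteq> w" "{x, y} = {u, w}"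
    using bspec[OF assms(1)[unfolded edges_on_def] assms(2)] by auto
  then show "x \<in> V" "y \<in> V" "x \<noteq> y" by (auto simp: doubleton_eq_iff)
qed

lemma edges_on_disjoint_star:
  "edges_on V E \<Longrightarrow> v \<notin> V \<Longrightarrow> (\<And>p. p \<in> D \<Longrightarrow> v \<in> fst p) \<Longrightarrow> E \<inter> D = {}"
  using edges_on_subset by blast

lemma UNIV_colour: "(UNIV :: colour set) = {Blue, Red}"
  using colour.exhaust by auto

lemma edges_on_finite: "finite V \<Longrightarrow> edges_on V E \<Longrightarrow> finite E"
proof -
  assume V: "finite V" and E: "edges_on V E"
  have "E \<subseteq> Pow V \<times> UNIV" using edges_on_subset[OF E] by fastforce
  moreover have "finite (Pow V \<times> (UNIV :: colour set))" using V by (simp add: UNIV_colour)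
  ultimately show "finite E" using finite_subset by blast
qed

lemma ind_subset: "ind E W \<subseteq> E"
  unfolding ind_def by blast

lemma finite_ind [simp]: "finite E \<Longrightarrow> finite (ind E W)"
  unfolding ind_def by simp

lemma finite_blues [simp]: "finite E \<Longrightarrow> finite (blues E)"
  unfolding blues_def by simp

lemma blues_subset: "blues E \<subseteq> E"
  unfolding blues_def by blast

lemma blues_mono: "E \<subseteq> F \<Longrightarrow> blues E \<subseteq> blues F"
  unfolding blues_def by blast

lemma ind_Un: "ind (E \<union> F) W = ind E W \<union> ind F W"
  unfolding ind_def by blast

lemma ind_mono: "E \<subseteq> F \<Longrightarrow> W \<subseteq> U \<Longrightarrow> ind E W \<subseteq> ind F U"
  unfolding ind_def by blast

lemma card_ind_mono: "finite F \<Longrightarrow> E \<subseteq> F \<Longrightarrow> W \<subseteq> U \<Longrightarrow> card (ind E W) \<le> card (ind F U)"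
  by (simp add: card_mono ind_mono)

lemma ind_Int: "ind E W \<inter> ind E U = ind E (W \<inter> U)"
  unfolding ind_def by blast

lemma card_Diff1: "finite A \<Longrightarrow> a \<in> A \<Longrightarrow> card (A - {a}) + 1 = card A"
  by (metis Suc_eq_plus1 card_Suc_Diff1)

lemma edges_on_ind: "edges_on V E \<Longrightarrow> edges_on W (ind E W)"
  unfolding edges_on_def ind_def by fastforce

lemma ind_eq_emptyI: "edges_on V E \<Longrightarrow> finite W \<Longrightarrow> card W < 2 \<Longrightarrow> ind E W = {}"
proof (rule ccontr)
  assume E: "edges_on V E" and W: "finite W" "card W < 2" and "ind E W \<noteq> {}"
  then obtain p where p: "p \<in> E" "fst p \<subseteq> W" unfolding ind_def by blast
  then obtain u w where "u \<noteq> w" "fst p = {u, w}" using E unfolding edges_on_def by blast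
  then have "card {u, w} \<le> card W" using p W by (intro card_mono) auto
  then show False using W \<open>u \<noteq> w\<close> by simp
qed

text \<open>A single vertex meets the bound for 2 with equality, so any nonempty \<open>W\<close> is
  admissible; for 3 two vertices are needed. This difference decides later which blocking sets can
  be uncrossed.\<close>

lemma ksparse_2D:
  assumes "ksparse 2 V E" "finite V" "W \<subseteq> V" "W \<noteq> {}"
  shows "card (ind E W) + 2 \<le> 2 * card W"
proof (cases "ind E W = {}")
  case True
  have "card W > 0" using assms by (simp add: card_gt_0_iff finite_subset)
  then show ?thesis using True by simp
qed (use assms in \<open>auto simp: ksparse_def\<close>)

lemma ksparse_3D:
  assumes "ksparse 3 V E" "W \<subseteq> V" "2 \<le> card W"
  shows "card (ind E W) + 3 \<le> 2 * card W"
  by (cases "ind E W = {}") (use assms in \<open>auto simp: ksparse_def\<close>)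

text \<open>\<open>V'\<close> need not be related to \<open>V\<close>: all edges lie inside
  \<open>V\<close>, so replacing \<open>W\<close> by its intersection with \<open>V\<close> loses no
  edge and can only lower the bound. This serves both for deleting a vertex and for adding
  one.\<close>

lemma ksparse_mono:
  assumes "ksparse k V E" "edges_on V E" "F \<subseteq> E" "finite V'" "finite V"
  shows "ksparse k V' F"
  unfolding ksparse_def
proof (intro allI impI)
  fix W assume W: "W \<subseteq> V'" "ind F W \<noteq> {}"
  have "ind F W \<subseteq> ind E (W \<inter> V)"
    using edges_on_subset[OF assms(2)] assms(3) unfolding ind_def by blast
  moreover have "finite E" using assms edges_on_finite by blast
  ultimately have "card (ind F W) \<le> card (ind E (W \<inter> V))" "ind E (W \<inter> V) \<noteq> {}"
    using W by (auto intro: card_mono)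
  moreover have "card (W \<inter> V) \<le> card W" using W assms by (meson card_mono finite_subset inf_le1)
  ultimately show "card (ind F W) + k \<le> 2 * card W"
    using assms(1) unfolding ksparse_def by (meson add_le_mono1 inf_le2 le_trans mult_le_mono2)
qed

lemma sparse_iff_ksparse:
  assumes "bicoloured_multigraph G"
  shows "sparse k G \<longleftrightarrow> ksparse k (verts G) (edges G)"
proof -
  have G: "finite (verts G)" "edges_on (verts G) (edges G)"
    using assms by (auto simp: bicoloured_multigraph_alt)
  then have finE: "finite (edges G)" by (rule edges_on_finite)
  show ?thesis
  proof
    assume s: "sparse k G"
    show "ksparse k (verts G) (edges G)"
      unfolding ksparse_def
    proof (intro allI impI)
      fix W assume W: "W \<subseteq> verts G" "ind (edges G) W \<noteq> {}"
      let ?H = "\<lparr>verts = W, edges = ind (edges G) W\<rparr>"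
      have on: "edges_on W (ind (edges G) W)" using G edges_on_ind by blast
      then have "W \<noteq> {}" using W unfolding edges_on_def by blast
      then have "subgraph ?H G"
        using W G on finite_subset[OF W(1)] ind_subset[of "edges G" W]
        unfolding subgraph_def bicoloured_multigraph_alt by simp
      moreover have "card (edges ?H) > 0" using W finE by (simp add: card_gt_0_iff)
      ultimately have "int (card (edges ?H)) \<le> 2 * int (card (verts ?H)) - int k"
        using s unfolding sparse_def by blast
      then show "card (ind (edges G) W) + k \<le> 2 * card W" by simp
    qed
  next
    assume s: "ksparse k (verts G) (edges G)"
    show "sparse k G"
      unfolding sparse_def
    proof (intro allI impI)
      fix H assume H: "subgraph H G \<and> card (edges H) > 0"
      have "edges H \<subseteq> ind (edges G) (verts H)"
        using H edges_on_subset[of "verts H" "edges H"]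
        unfolding subgraph_def bicoloured_multigraph_alt ind_def by blast
      then have le: "card (edges H) \<le> card (ind (edges G) (verts H))"
        using finE by (intro card_mono) auto
      then have "ind (edges G) (verts H) \<noteq> {}" using H by auto
      then have "card (ind (edges G) (verts H)) + k \<le> 2 * card (verts H)"
        using s H unfolding ksparse_def subgraph_def by blast
      then show "int (card (edges H)) \<le> 2 * int (card (verts H)) - int k" using le by linarith
    qed
  qed
qed

text \<open>Sparsity passes to subgraphs, so it suffices to test the largest blue subgraph, which
  keeps all vertices and all blue edges.\<close>

lemma limited_iff_ksparse:
  assumes "bicoloured_multigraph G"
  shows "limited G \<longleftrightarrow> ksparse 3 (verts G) (blues (edges G))"
proof -
  let ?B = "\<lparr>verts = verts G, edges = blues (edges G)\<rparr>"
  have B: "bicoloured_multigraph ?B"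
    using assms edges_on_mono[OF _ order_refl blues_subset] unfolding bicoloured_multigraph_alt by auto
  have "limited G \<longleftrightarrow> sparse 3 ?B"
  proof
    assume "limited G"
    moreover have "subgraph ?B G" "\<forall>(e, c) \<in> edges ?B. c = Blue"
      using B unfolding subgraph_def by (auto simp: blues_def)
    ultimately show "sparse 3 ?B" unfolding limited_def by blast
  next
    assume s: "sparse 3 ?B"
    show "limited G"
      unfolding limited_def
    proof (intro allI impI)
      fix H assume H: "subgraph H G \<and> (\<forall>(e, c) \<in> edges H. c = Blue)"
      have "subgraph K ?B" if "subgraph K H" for K
        using that H unfolding subgraph_def blues_def by fastforce
      then show "sparse 3 H" using s unfolding sparse_def by blast
    qed
  qed
  then show ?thesis using sparse_iff_ksparse[OF B] by simp
qed

locale tight_limited =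
  fixes V :: "'a set" and E :: "('a set \<times> colour) set"
  assumes finite_V: "finite V"
    and nonempty: "V \<noteq> {}"
    and on: "edges_on V E"
    and card_E: "card E + 2 = 2 * card V"
    and sparse2: "ksparse 2 V E"
    and blue_sparse: "ksparse 3 V (blues E)"

lemma tight_limited_iff:
  "bicoloured_multigraph G \<and> tight 2 G \<and> limited G \<longleftrightarrow> tight_limited (verts G) (edges G)"
proof (cases "bicoloured_multigraph G")
  case True
  have "(int (card (edges G)) = 2 * int (card (verts G)) - int 2) =
      (card (edges G) + 2 = 2 * card (verts G))" by linarith
  then show ?thesis
    using True sparse_iff_ksparse[OF True, of 2] limited_iff_ksparse[OF True]
    unfolding tight_def tight_limited_def bicoloured_multigraph_alt by auto
qed (auto simp: tight_limited_def bicoloured_multigraph_alt)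

section \<open>The moves preserve tightness and limitedness\<close>

text \<open>Each of the |W| - 1 vertices other than \<open>v\<close> carries at most two edges to
  \<open>v\<close>, one per colour. Without parallel edges it carries at most one, and |W| - 1 \<le>
  2|W| - 3 because an edge inside \<open>W\<close> forces |W| \<ge> 2.\<close>

lemma card_star_le:
  assumes star: "\<And>p. p \<in> D \<Longrightarrow> \<exists>u. u \<noteq> v \<and> fst p = {u, v}"
    and fin: "finite W" and ne: "ind D W \<noteq> {}"
  shows "card (ind D W) + 2 \<le> 2 * card W"
    and "inj_on fst D \<Longrightarrow> card (ind D W) + 3 \<le> 2 * card W"
proof -
  let ?S = "(\<lambda>u. {u, v}) ` (W - {v})"
  have im: "fst p \<in> ?S \<and> v \<in> W \<and> W - {v} \<noteq> {}" if p: "p \<in> ind D W" for p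
  proof -
    have "p \<in> D" "fst p \<subseteq> W" using p unfolding ind_def by simp_all
    with star[of p] obtain u where "u \<noteq> v" "fst p = {u, v}" "u \<in> W" "v \<in> W" by auto
    then show ?thesis by auto
  qed
  obtain p where "p \<in> ind D W" using ne by blast
  then have "v \<in> W" "W - {v} \<noteq> {}" using im by simp_all
  then have W: "card (W - {v}) + 1 = card W" "card (W - {v}) > 0"
    using fin card_Diff1[of W v] by (simp, metis card_gt_0_iff finite_Diff)
  have S: "finite ?S" "card ?S \<le> card (W - {v})" using fin by (simp_all add: card_image_le)
  have "ind D W \<subseteq> ?S \<times> {Blue, Red}"
  proof
    fix p assume "p \<in> ind D W"
    then have "fst p \<in> ?S" using im by simp
    moreover have "snd p \<in> {Blue, Red}" using UNIV_colour by blast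
    ultimately show "p \<in> ?S \<times> {Blue, Red}" by (simp only: mem_Times_iff)
  qed
  then have "card (ind D W) \<le> card (?S \<times> {Blue, Red})" using S(1) by (intro card_mono) simp_all
  then have "card (ind D W) \<le> 2 * card ?S" by (simp add: card_cartesian_product mult.commute)
  then show "card (ind D W) + 2 \<le> 2 * card W" using S W by linarith
  assume "inj_on fst D"
  then have "inj_on fst (ind D W)" using ind_subset by (rule inj_on_subset)
  then have "card (ind D W) = card (fst ` ind D W)" by (simp add: card_image)
  also have "fst ` ind D W \<subseteq> ?S" using im by (meson image_subsetI)
  then have "card (fst ` ind D W) \<le> card ?S" using S(1) by (intro card_mono)
  finally show "card (ind D W) + 3 \<le> 2 * card W" using S W by linarith
qed

text \<open>Only sets containing \<open>v\<close> are new. The vertex \<open>v\<close> adds two to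
  the right-hand side, which is what \<open>step\<close> uses. If the old part spans no edge, its
  sparsity says nothing, and the star alone is counted by \<open>card_star_le\<close>.\<close>

lemma ksparse_add_vertex:
  assumes "finite V" "edges_on V E" "v \<notin> V" "ksparse k V E" "finite D"
    and star: "\<And>p. p \<in> D \<Longrightarrow> \<exists>u. u \<noteq> v \<and> fst p = {u, v}"
    and k: "k = 2 \<or> k = 3 \<and> inj_on fst D"
    and step: "\<And>W. W \<subseteq> V \<Longrightarrow> ind E W \<noteq> {} \<Longrightarrow>
      card (ind E W) + card (ind D (insert v W)) + k \<le> 2 * card W + 2"
  shows "ksparse k (insert v V) (E \<union> D)"
  unfolding ksparse_def
proof (intro allI impI)
  fix W assume W: "W \<subseteq> insert v V" "ind (E \<union> D) W \<noteq> {}"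
  then have finW: "finite W" using assms(1) finite_subset by (metis finite_insert)
  have finE: "finite E" using assms(1,2) by (rule edges_on_finite)
  show "card (ind (E \<union> D) W) + k \<le> 2 * card W"
  proof (cases "v \<in> W")
    case False
    then have "ind D W = {}" using star unfolding ind_def by fastforce
    then show ?thesis using W False assms(4) unfolding ind_Un ksparse_def
      by (metis Un_empty_right subset_insert)
  next
    case True
    define U where "U = W - {v}"
    then have U: "U \<subseteq> V" "W = insert v U" "card W = card U + 1"
      using True W finW card_Diff1[of W v] by auto
    have eq: "ind E W = ind E U"
      using edges_on_subset[OF assms(2)] assms(3) unfolding ind_def U_def by blast
    show ?thesis
    proof (cases "ind E U = {}")
      case False
      have "card (ind (E \<union> D) W) \<le> card (ind E U) + card (ind D W)"
        unfolding ind_Un eq by (rule card_Un_le)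
      then show ?thesis using step[OF U(1) False] U by simp
    next
      case True
      then have "ind (E \<union> D) W = ind D W" unfolding ind_Un eq by simp
      moreover have "ind D W \<noteq> {}" using calculation W(2) by simp
      ultimately show ?thesis using card_star_le[of D v W, OF star finW] k by metis
    qed
  qed
qed

text \<open>Two new edges are paid for by the new vertex. A third one counts only if all ends of
  \<open>D\<close> lie in the set; then the deleted edge \<open>f\<close> lies in it as well and
  compensates. The lemma covers 0- and 1-extensions, both for all edges and for the blue
  ones.\<close>

lemma ksparse_star_extension:
  assumes "finite V" "edges_on V E" "v \<notin> V" "ksparse k V E" "finite D"
    and star: "\<And>p. p \<in> D \<Longrightarrow> \<exists>u. u \<noteq> v \<and> fst p = {u, v}"
    and k: "k = 2 \<or> k = 3 \<and> inj_on fst D"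
    and D: "card D \<le> 2 \<or> card D \<le> 3 \<and> f \<in> E \<and> fst f \<subseteq> \<Union> (fst ` D)"
  shows "ksparse k (insert v V) (E - {f} \<union> D)"
proof (rule ksparse_add_vertex)
  have finE: "finite E" using assms(1,2) by (rule edges_on_finite)
  show "ksparse k V (E - {f})" using ksparse_mono assms(1,2,4) by blast
  fix W assume W: "W \<subseteq> V" "ind (E - {f}) W \<noteq> {}"
  have sub: "ind (E - {f}) W \<subseteq> ind E W" by (intro ind_mono) auto
  have E: "card (ind E W) + k \<le> 2 * card W" using assms(4) W sub unfolding ksparse_def by blast
  have le: "card (ind (E - {f}) W) \<le> card (ind E W)" using sub finE by (simp add: card_mono)
  show "card (ind (E - {f}) W) + card (ind D (insert v W)) + k \<le> 2 * card W + 2"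
  proof (cases "card (ind D (insert v W)) \<le> 2")
    case True
    then show ?thesis using E le by linarith
  next
    case False
    moreover have *: "card (ind D (insert v W)) \<le> card D"
      using assms(5) ind_subset by (metis card_mono)
    ultimately have D': "card D = 3" "card (ind D (insert v W)) = 3" "f \<in> E" "fst f \<subseteq> \<Union> (fst ` D)"
      using D by auto
    then have "ind D (insert v W) = D" using assms(5) ind_subset by (metis card_subset_eq)
    then have "fst f \<subseteq> insert v W" using D'(4) unfolding ind_def by blast
    moreover have "v \<notin> fst f" using edges_on_subset[OF assms(2) D'(3)] assms(3) by blast
    ultimately have "f \<in> ind E W" using D'(3) unfolding ind_def by blast
    moreover have "ind (E - {f}) W = ind E W - {f}" unfolding ind_def by blast
    ultimately have "card (ind (E - {f}) W) + 1 = card (ind E W)"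
      using finE card_Diff1[of "ind E W" f] by simp
    then show ?thesis using E D' by linarith
  qed
qed (use assms in \<open>auto intro: edges_on_mono\<close>)

lemma blues_Un: "blues (E \<union> F) = blues E \<union> blues F"
  unfolding blues_def by blast

lemma blues_Diff: "blues (E - F) = blues E - F"
  unfolding blues_def by blast

lemma inj_on_fst_blues: "inj_on fst (blues E)"
  unfolding inj_on_def blues_def by (auto simp: prod_eq_iff)

lemma edges_on_blues: "edges_on V E \<Longrightarrow> edges_on V (blues E)"
  using edges_on_mono blues_subset by (metis order_refl)

context tight_limited
begin

lemma finite_E: "finite E"
  using finite_V on by (rule edges_on_finite)

lemma finite_Sub: "W \<subseteq> V \<Longrightarrow> finite W"
  using finite_V finite_subset by blast

lemma tight_limited_insert:
  assumes "v \<notin> V" "card F = card E + 2" "edges_on (insert v V) F"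
    "ksparse 2 (insert v V) F" "ksparse 3 (insert v V) (blues F)"
  shows "tight_limited (insert v V) F"
  using assms finite_V card_E by (intro tight_limited.intro) simp_all

lemma zero_extension_tight_limited:
  assumes "v \<notin> V" "x \<in> V" "y \<in> V" "x = y \<longrightarrow> c \<noteq> d"
  shows "tight_limited (insert v V) (E \<union> {({v, x}, c), ({v, y}, d)})"
proof -
  define D where "D = {({v, x}, c), ({v, y}, d)}"
  \<comment> \<open>A dummy that is no edge at all, so that deleting it changes nothing and the
    lemma shared with 1-extensions applies.\<close>
  define f :: "'a set \<times> colour" where "f = ({}, Blue)"
  have vx: "x \<noteq> v" "y \<noteq> v" using assms by auto
  have star: "\<exists>u. u \<noteq> v \<and> fst p = {u, v}" if "p \<in> D" for p
    using that vx unfolding D_def by (elim insertE emptyE) (simp_all, (metis insert_commute)+)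
  have D2: "card D = 2" and finD: "finite D"
    using assms vx unfolding D_def by (auto simp: card_insert_if doubleton_eq_iff)
  have "fst p \<noteq> {}" if "p \<in> E" for p
    using bspec[OF on[unfolded edges_on_def] that] by auto
  from this[of f] have "f \<notin> E" unfolding f_def by auto
  then have f: "E - {f} = E" "blues E - {f} = blues E" using blues_subset by blast+
  have "ksparse 2 (insert v V) (E - {f} \<union> D)"
    by (rule ksparse_star_extension[OF finite_V on assms(1) sparse2 finD star]) (use D2 in simp_all)
  then have "ksparse 2 (insert v V) (E \<union> D)" unfolding f .
  moreover have "ksparse 3 (insert v V) (blues E - {f} \<union> blues D)"
  proof (rule ksparse_star_extension[OF finite_V edges_on_blues[OF on] assms(1) blue_sparse])
    show "card (blues D) \<le> 2 \<or> card (blues D) \<le> 3 \<and> f \<in> blues E \<and> fst f \<subseteq> \<Union> (fst ` blues D)"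
      using card_mono[OF finD blues_subset] D2 by simp
    show "\<exists>u. u \<noteq> v \<and> fst p = {u, v}" if "p \<in> blues D" for p
      using star that blues_subset by blast
  qed (simp_all add: inj_on_fst_blues finD)
  then have "ksparse 3 (insert v V) (blues E \<union> blues D)" unfolding f .
  moreover have "card (E \<union> D) = card E + 2"
  proof -
    have "v \<in> fst p" if "p \<in> D" for p using star[OF that] by auto
    then have "E \<inter> D = {}" by (rule edges_on_disjoint_star[OF on assms(1)])
    then show ?thesis using finite_E finD D2 card_Un_disjoint[of E D] by simp
  qed
  moreover have "edges_on (insert v V) D"
    unfolding D_def by (intro edges_on_insertI edges_on_empty) (use assms vx in simp_all)
  then have "edges_on (insert v V) (E \<union> D)"
    unfolding edges_on_Un using edges_on_mono[OF on subset_insertI order_refl] by simp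
  ultimately have "tight_limited (insert v V) (E \<union> D)"
    by (simp only: tight_limited_insert[OF assms(1)] blues_Un)
  then show ?thesis unfolding D_def .
qed

text \<open>The colour restriction is needed only when all three new edges are blue: then the
  deleted edge must be blue too, or nothing would compensate the third edge in the blue
  count.\<close>

lemma one_extension_tight_limited:
  assumes "({x, y}, c1) \<in> E" "v \<notin> V" "z \<in> V" "z = x \<longrightarrow> c \<noteq> c2" "z = y \<longrightarrow> c \<noteq> c3"
    and rbb: "\<not> (c1 = Red \<and> c2 = Blue \<and> c3 = Blue)"
  shows "tight_limited (insert v V) (E - {({x, y}, c1)} \<union> {({x, v}, c2), ({y, v}, c3), ({v, z}, c)})"
proof -
  define D where "D = {({x, v}, c2), ({y, v}, c3), ({v, z}, c)}"
  define f where "f = ({x, y}, c1)"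
  have fE: "f \<in> E" using assms(1) unfolding f_def .
  have xy: "x \<in> V" "y \<in> V" "x \<noteq> y"
    using edges_on_ends[OF on assms(1)] by auto
  then have vx: "x \<noteq> v" "y \<noteq> v" "z \<noteq> v" using assms by auto
  have star: "\<exists>u. u \<noteq> v \<and> fst p = {u, v}" if "p \<in> D" for p
    using that vx unfolding D_def by (elim insertE emptyE) (simp_all, (metis insert_commute)+)
  have D3: "card D = 3" and finD: "finite D"
    using assms vx xy unfolding D_def by (auto simp: card_insert_if doubleton_eq_iff)
  have fD: "fst f \<subseteq> \<Union> (fst ` D)" unfolding D_def f_def by auto
  have "ksparse 2 (insert v V) (E - {f} \<union> D)"
    by (rule ksparse_star_extension[OF finite_V on assms(2) sparse2 finD star])
      (use D3 fD fE in simp_all)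
  moreover have "ksparse 3 (insert v V) (blues E - {f} \<union> blues D)"
  proof (rule ksparse_star_extension[OF finite_V edges_on_blues[OF on] assms(2) blue_sparse])
    have le: "card (blues D) \<le> 3" using card_mono[OF finD blues_subset] D3 by simp
    show "card (blues D) \<le> 2 \<or> card (blues D) \<le> 3 \<and> f \<in> blues E \<and> fst f \<subseteq> \<Union> (fst ` blues D)"
    proof (cases "card (blues D) \<le> 2")
      case False
      then have eq: "blues D = D"
        using le D3 finD by (intro card_subset_eq blues_subset) simp_all
      then have "snd p = Blue" if "p \<in> D" for p using that unfolding blues_def by blast
      from this[of "({x, v}, c2)"] this[of "({y, v}, c3)"] have "c2 = Blue" "c3 = Blue"
        unfolding D_def by simp_all
      then have "snd f = Blue" using rbb colour.exhaust unfolding f_def by auto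
      then have "f \<in> blues E" using fE unfolding blues_def by blast
      then show ?thesis using le fD eq by simp
    qed simp
    show "\<exists>u. u \<noteq> v \<and> fst p = {u, v}" if "p \<in> blues D" for p
      using star that blues_subset by blast
  qed (simp_all add: inj_on_fst_blues finD)
  moreover have "card (E - {f} \<union> D) = card E + 2"
  proof -
    have "v \<in> fst p" if "p \<in> D" for p using star[OF that] by auto
    then have "E \<inter> D = {}" by (rule edges_on_disjoint_star[OF on assms(2)])
    then have "(E - {f}) \<inter> D = {}" by blast
    then show ?thesis
      using finite_E finD D3 card_Un_disjoint[of "E - {f}" D] card_Diff1[OF finite_E fE] by simp
  qed
  moreover have "edges_on (insert v V) D"
    unfolding D_def by (intro edges_on_insertI edges_on_empty) (use assms vx xy in simp_all)
  then have "edges_on (insert v V) (E - {f} \<union> D)"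
    unfolding edges_on_Un using edges_on_mono[OF on subset_insertI Diff_subset] by simp
  ultimately have "tight_limited (insert v V) (E - {f} \<union> D)"
    by (simp only: tight_limited_insert[OF assms(2)] blues_Un blues_Diff)
  then show ?thesis unfolding D_def f_def .
qed

text \<open>All added edges are red, so blue sparsity is inherited, and only the total count needs
  work. It is done in two stages: four edges are exchanged for the red triangle, giving
  \<open>?E1\<close>, and then \<open>v\<close> is attached by the star \<open>?D\<close>.\<close>

lemma K2K2_substitution_tight_limited:
  assumes d: "distinct [x, y, z]" and xyz: "{x, y, z} \<subseteq> V" and v: "v \<notin> V"
    and F: "{({x, y}, Blue), ({x, y}, Red), ({y, z}, Blue), ({y, z}, Red)} \<subseteq> E" (is "?F \<subseteq> E")
    and xz: "({x, z}, Red) \<notin> E"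
  shows "tight_limited (insert v V) (E - ?F \<union> {({x, y}, Red), ({x, z}, Red), ({y, z}, Red),
    ({x, v}, Red), ({y, v}, Red), ({z, v}, Red)})" (is "tight_limited _ ?E'")
proof -
  let ?T = "{({x, y}, Red), ({x, z}, Red), ({y, z}, Red)}"
  let ?D = "{({x, v}, Red), ({y, v}, Red), ({z, v}, Red)}"
  let ?E1 = "E - ?F \<union> ?T"
  have E': "?E' = ?E1 \<union> ?D" by auto
  have vx: "x \<noteq> v" "y \<noteq> v" "z \<noteq> v" using v xyz by auto
  have F4: "card ?F = 4" using d by (auto simp: card_insert_if doubleton_eq_iff)
  have T3: "card ?T = 3" using d by (auto simp: card_insert_if doubleton_eq_iff)
  have D3: "card ?D = 3" using d vx by (auto simp: card_insert_if doubleton_eq_iff)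
  have EF: "card (E - ?F) + 4 = card E"
    using F F4 finite_E card_Diff_subset[of ?F E] card_mono[of E ?F] by simp
  have disj: "(E - ?F) \<inter> ?T = {}" using xz by auto
  have on1: "edges_on V ?E1"
    unfolding edges_on_Un using edges_on_mono[OF on order_refl Diff_subset]
    by (intro conjI edges_on_insertI edges_on_empty) (use xyz d in simp_all)
  have star: "\<exists>u. u \<noteq> v \<and> fst p = {u, v}" if "p \<in> ?D" for p
    using that vx by auto
  have full: "card (ind ?E1 W) + 1 \<le> card (ind E W)" if W: "x \<in> W" "y \<in> W" "z \<in> W" for W
  proof -
    have "?F \<subseteq> ind E W" using F W unfolding ind_def by auto
    then have "card (ind E W - ?F) + 4 = card (ind E W)"
      using F4 finite_E card_Diff_subset[of ?F "ind E W"] card_mono[of "ind E W" ?F] by simp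
    moreover have "ind ?E1 W \<subseteq> (ind E W - ?F) \<union> ?T" unfolding ind_def by blast
    then have "card (ind ?E1 W) \<le> card ((ind E W - ?F) \<union> ?T)" using finite_E by (intro card_mono) auto
    moreover have "card ((ind E W - ?F) \<union> ?T) \<le> card (ind E W - ?F) + 3"
      using card_Un_le[of "ind E W - ?F" ?T] T3 by simp
    ultimately show ?thesis by linarith
  qed
  have sp1: "card (ind ?E1 W) + 2 \<le> 2 * card W" if W: "W \<subseteq> V" "W \<noteq> {}" for W
  proof -
    have fW: "finite W" using W finite_Sub by blast
    have EW: "card (ind E W) + 2 \<le> 2 * card W" using ksparse_2D[OF sparse2 finite_V] W by blast
    consider "x \<in> W" "y \<in> W" "z \<in> W" | "x \<in> W" "z \<in> W" "y \<notin> W" | "\<not> (x \<in> W \<and> z \<in> W)" by blast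
    then show ?thesis
    proof cases
      case 1
      then show ?thesis using full EW by fastforce
    next
      case 2
      \<comment> \<open>Here the red edge \<open>xz\<close> may be a gain. Adding \<open>y\<close>
        to \<open>W\<close> brings in all four edges of \<open>?F\<close> at the price of one
        vertex, so \<open>W\<close> had slack at least two before.\<close>
      have "insert y W \<subseteq> V" using W xyz by auto
      then have "card (ind E (insert y W)) + 2 \<le> 2 * card (insert y W)"
        using ksparse_2D[OF sparse2 finite_V] by blast
      moreover have "ind E W \<union> ?F \<subseteq> ind E (insert y W)" using F 2 unfolding ind_def by auto
      then have "card (ind E W \<union> ?F) \<le> card (ind E (insert y W))" using finite_E by (intro card_mono) auto
      moreover have "ind E W \<inter> ?F = {}" using 2 unfolding ind_def by auto
      then have "card (ind E W \<union> ?F) = card (ind E W) + 4"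
        using finite_E F4 card_Un_disjoint[of "ind E W" ?F] by simp
      moreover have "ind ?E1 W \<subseteq> insert ({x, z}, Red) (ind E W)" using 2 unfolding ind_def by auto
      then have "card (ind ?E1 W) \<le> card (insert ({x, z}, Red) (ind E W))"
        using finite_E by (intro card_mono) auto
      moreover have "card (insert ({x, z}, Red) (ind E W)) \<le> card (ind E W) + 1"
        using finite_E by (simp add: card_insert_if)
      ultimately show ?thesis using fW 2 by simp
    next
      case 3
      then have "ind ?E1 W \<subseteq> ind E W" using F unfolding ind_def by auto
      then have "card (ind ?E1 W) \<le> card (ind E W)" using finite_E by (intro card_mono) auto
      then show ?thesis using EW by linarith
    qed
  qed
  have "ksparse 2 (insert v V) (?E1 \<union> ?D)"
  proof (rule ksparse_add_vertex[OF finite_V on1 v])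
    show "ksparse 2 V ?E1"
      unfolding ksparse_def
    proof (intro allI impI)
      fix W assume W: "W \<subseteq> V" "ind ?E1 W \<noteq> {}"
      then have "W \<noteq> {}" using ind_eq_emptyI[OF on1, of "{}"] by (metis card.empty finite.emptyI zero_less_numeral)
      with W(1) show "card (ind ?E1 W) + 2 \<le> 2 * card W" by (rule sp1)
    qed
    fix W assume W: "W \<subseteq> V" "ind ?E1 W \<noteq> {}"
    then have W0: "W \<noteq> {}" using ind_eq_emptyI[OF on1, of "{}"] by (metis card.empty finite.emptyI zero_less_numeral)
    \<comment> \<open>The new vertex pays for two edges. All three are present only if
      \<open>W\<close> contains \<open>x\<close>, \<open>y\<close> and \<open>z\<close>, and there
      \<open>full\<close> has freed one unit.\<close>
    show "card (ind ?E1 W) + card (ind ?D (insert v W)) + 2 \<le> 2 * card W + 2"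
    proof (cases "x \<in> W \<and> y \<in> W \<and> z \<in> W")
      case True
      have "card (ind ?D (insert v W)) \<le> card ?D" by (rule card_mono[OF _ ind_subset]) simp
      moreover have "card (ind E W) + 2 \<le> 2 * card W" using ksparse_2D[OF sparse2 finite_V W(1) W0] .
      ultimately show ?thesis using full[of W] True D3 by linarith
    next
      case False
      then obtain u where u: "u \<notin> W" "u = x \<or> u = y \<or> u = z" by metis
      then have "u \<noteq> v" using vx by metis
      then have "({u, v}, Red) \<notin> ind ?D (insert v W)" using u(1) unfolding ind_def by simp
      moreover have "({u, v}, Red) \<in> ?D" using u(2) by (elim disjE) simp_all
      ultimately have "ind ?D (insert v W) \<noteq> ?D" by metis
      then have "card (ind ?D (insert v W)) < card ?D"
        by (intro psubset_card_mono psubsetI ind_subset) simp_all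
      then show ?thesis using sp1[OF W(1) W0] D3 by linarith
    qed
  qed (use star in simp_all)
  then have sp2': "ksparse 2 (insert v V) ?E'" unfolding E' .
  have "blues ?T = {}" "blues ?D = {}" unfolding blues_def by auto
  then have "blues ?E' \<subseteq> blues E" unfolding E' blues_Un blues_Diff by blast
  then have sp3': "ksparse 3 (insert v V) (blues ?E')"
    using ksparse_mono[OF blue_sparse edges_on_blues[OF on]] finite_V by (metis finite_insert)
  have on': "edges_on (insert v V) ?E'"
    unfolding E' edges_on_Un[of _ ?E1]
  proof
    show "edges_on (insert v V) ?E1" by (rule edges_on_mono[OF on1 subset_insertI order_refl])
    show "edges_on (insert v V) ?D"
      by (intro edges_on_insertI edges_on_empty) (use xyz vx in simp_all)
  qed
  have "card ?E' = card E + 2"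
  proof -
    have d: "?E1 \<inter> ?D = {}" by (rule edges_on_disjoint_star[OF on1 v]) (elim insertE emptyE, simp_all)
    have "finite ?E1" using finite_V on1 by (rule edges_on_finite)
    then have "card ?E' = card ?E1 + card ?D" unfolding E' by (rule card_Un_disjoint[OF _ _ d]) simp
    moreover have "card ?E1 = card (E - ?F) + card ?T"
      by (rule card_Un_disjoint[OF _ _ disj]) (simp_all add: finite_E)
    ultimately show ?thesis using T3 D3 EF by linarith
  qed
  then show ?thesis by (rule tight_limited_insert[OF v _ on' sp2' sp3'])
qed

end

lemma permitted_move_tight_limited:
  assumes "permitted_move G G'" "tight_limited (verts G) (edges G)"
  shows "tight_limited (verts G') (edges G')"
proof -
  interpret tight_limited "verts G" "edges G" by fact
  show ?thesis
    using assms(1) unfolding permitted_move_def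
  proof (elim disjE)
    assume "K2K2_substitution G G'"
    then show ?thesis
      unfolding K2K2_substitution_def using K2K2_substitution_tight_limited by (clarsimp simp: insert_commute)
  next
    assume "zero_extension G G'"
    then obtain v x y c d where "v \<notin> verts G" "x \<in> verts G" "y \<in> verts G" "x = y \<longrightarrow> c \<noteq> d"
      "G' = \<lparr>verts = insert v (verts G), edges = edges G \<union> {({v, x}, c), ({v, y}, d)}\<rparr>"
      unfolding zero_extension_def by blast
    then show ?thesis using zero_extension_tight_limited[of v x y c d] by simp
  next
    assume "permitted_one_extension G G'"
    then obtain x y c1 v c2 c3 z c where "one_extension G x y c1 v c2 c3 z c G'"
      "\<not> colour_case_r_bb c1 c2 c3"
      unfolding permitted_one_extension_def by blast
    then show ?thesis
      using one_extension_tight_limited[of x y c1 v z c c2 c3]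
      unfolding one_extension_def colour_case_r_bb_def by simp
  qed
qed

lemma tight_limited_K1: "tight_limited {u} {}"
  by unfold_locales (auto simp: ksparse_def ind_def blues_def)

section \<open>Reduction at a vertex of degree at most three\<close>

definition star :: "('a set \<times> colour) set \<Rightarrow> 'a \<Rightarrow> ('a set \<times> colour) set" where
  "star E v = {p \<in> E. v \<in> fst p}"

definition rest :: "('a set \<times> colour) set \<Rightarrow> 'a \<Rightarrow> ('a set \<times> colour) set" where
  "rest E v = {p \<in> E. v \<notin> fst p}"

text \<open>Room for one more edge: 3 is the sparsity constant 2 plus one, and
  \<open>blue_feasible\<close> has 4 for the blue constant 3. A set avoiding \<open>v\<close>
  induces the same edges in \<open>E\<close> as in \<open>rest E v\<close>, so the count can stay in
  \<open>E\<close>.\<close>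

definition feasible :: "'a set \<Rightarrow> ('a set \<times> colour) set \<Rightarrow> 'a \<Rightarrow> 'a \<Rightarrow> 'a \<Rightarrow> bool" where
  "feasible V E v p q \<longleftrightarrow>
     (\<forall>W \<subseteq> V - {v}. p \<in> W \<longrightarrow> q \<in> W \<longrightarrow> card (ind E W) + 3 \<le> 2 * card W)"

definition blue_feasible :: "'a set \<Rightarrow> ('a set \<times> colour) set \<Rightarrow> 'a \<Rightarrow> 'a \<Rightarrow> 'a \<Rightarrow> bool" where
  "blue_feasible V E v p q \<longleftrightarrow>
     (\<forall>W \<subseteq> V - {v}. p \<in> W \<longrightarrow> q \<in> W \<longrightarrow> card (ind (blues E) W) + 4 \<le> 2 * card W)"

definition reducible :: "'a set \<Rightarrow> ('a set \<times> colour) set \<Rightarrow> bool" where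
  "reducible V E \<longleftrightarrow> (\<exists>V0 E0. tight_limited V0 E0 \<and> card V0 < card V \<and>
     permitted_move \<lparr>verts = V0, edges = E0\<rparr> \<lparr>verts = V, edges = E\<rparr>)"

lemma feasibleD:
  "feasible V E v p q \<Longrightarrow> W \<subseteq> V - {v} \<Longrightarrow> p \<in> W \<Longrightarrow> q \<in> W \<Longrightarrow> card (ind E W) + 3 \<le> 2 * card W"
  unfolding feasible_def by metis

lemma blue_feasibleD:
  "blue_feasible V E v p q \<Longrightarrow> W \<subseteq> V - {v} \<Longrightarrow> p \<in> W \<Longrightarrow> q \<in> W \<Longrightarrow>
    card (ind (blues E) W) + 4 \<le> 2 * card W"
  unfolding blue_feasible_def by metis

lemma blues_insert: "blues (insert p E) = (if snd p = Blue then insert p (blues E) else blues E)"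
  unfolding blues_def by (rule set_eqI, simp, metis)

lemma card_three_distinct: "card {a, b, c} = 3 \<Longrightarrow> a \<noteq> b \<and> a \<noteq> c \<and> b \<noteq> c"
  by (auto simp: card_insert_if split: if_splits)

lemma star_Un_rest: "rest E v \<union> star E v = E"
  unfolding star_def rest_def by blast

lemma star_Int_rest: "rest E v \<inter> star E v = {}"
  unfolding star_def rest_def by blast

lemma star_subset: "star E v \<subseteq> E"
  unfolding star_def by simp

lemma rest_subset: "rest E v \<subseteq> E"
  unfolding rest_def by simp

lemma card_star_rest: "finite E \<Longrightarrow> card (rest E v) + card (star E v) = card E"
  by (metis card_Un_disjoint finite_subset rest_subset star_Int_rest star_Un_rest star_subset)

lemma edges_on_rest:
  assumes "edges_on V E"
  shows "edges_on (V - {v}) (rest E v)"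
  unfolding edges_on_def
proof
  fix p assume "p \<in> rest E v"
  then have p: "p \<in> E" "v \<notin> fst p" unfolding rest_def by simp_all
  then obtain u w where "u \<in> V" "w \<in> V" "u \<noteq> w" "fst p = {u, w}"
    using bspec[OF assms[unfolded edges_on_def] p(1)] by auto
  moreover from this have "u \<in> V - {v}" "w \<in> V - {v}" using p(2) by auto
  ultimately show "\<exists>u\<in>V - {v}. \<exists>w\<in>V - {v}. u \<noteq> w \<and> fst p = {u, w}" by metis
qed

lemma bicoloured_multigraphI:
  "tight_limited V E \<Longrightarrow> bicoloured_multigraph \<lparr>verts = V, edges = E\<rparr>"
  unfolding bicoloured_multigraph_alt tight_limited_def by simp

text \<open>An edge inside \<open>W\<close> or \<open>U\<close> lies inside the union, and one
  inside both lies inside the intersection. This is the uncrossing inequality for blocking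
  sets.\<close>

lemma card_ind_supermodular:
  assumes "finite E"
  shows "card (ind E W) + card (ind E U) \<le> card (ind E (W \<union> U)) + card (ind E (W \<inter> U))"
proof -
  have "card (ind E W) + card (ind E U) = card (ind E W \<union> ind E U) + card (ind E W \<inter> ind E U)"
    using assms by (intro card_Un_Int) simp_all
  moreover have "card (ind E W \<union> ind E U) \<le> card (ind E (W \<union> U))"
    using assms by (intro card_mono) (simp_all add: ind_mono)
  ultimately show ?thesis unfolding ind_Int by linarith
qed

lemma ksparse_insert_edge:
  assumes "finite E" "ksparse k V E"
    and "\<And>W. W \<subseteq> V \<Longrightarrow> fst f \<subseteq> W \<Longrightarrow> card (ind E W) + k + 1 \<le> 2 * card W"
  shows "ksparse k V (insert f E)"
  unfolding ksparse_def
proof (intro allI impI)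
  fix W assume W: "W \<subseteq> V" "ind (insert f E) W \<noteq> {}"
  show "card (ind (insert f E) W) + k \<le> 2 * card W"
  proof (cases "fst f \<subseteq> W")
    case True
    then have "ind (insert f E) W = insert f (ind E W)" unfolding ind_def by auto
    then have "card (ind (insert f E) W) \<le> card (ind E W) + 1"
      using assms(1) by (simp add: card_insert_if)
    then show ?thesis using assms(3)[OF W(1) True] by linarith
  next
    case False
    then have "ind (insert f E) W = ind E W" unfolding ind_def by auto
    then show ?thesis using assms(2) W unfolding ksparse_def by simp
  qed
qed

section \<open>Undoing 0-extensions and 1-extensions\<close>

context tight_limited
begin

lemma ksparse_rest: "ksparse 2 (V - {v}) (rest E v)" "ksparse 3 (V - {v}) (blues (rest E v))"
  using ksparse_mono[OF sparse2 on rest_subset]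
    ksparse_mono[OF blue_sparse edges_on_blues[OF on] blues_mono[OF rest_subset]] finite_V
  by simp_all

lemma card_remove: "v \<in> V \<Longrightarrow> card (V - {v}) + 1 = card V"
  using finite_V by (rule card_Diff1)

lemma remove_degree_two:
  assumes "v \<in> V" "card (star E v) = 2" "V \<noteq> {v}"
  shows "tight_limited (V - {v}) (rest E v)"
proof
  show "V - {v} \<noteq> {}" using assms nonempty by blast
  show "card (rest E v) + 2 = 2 * card (V - {v})"
    using card_star_rest[OF finite_E, of v] card_remove[OF assms(1)] card_E assms(2) by linarith
qed (use finite_V edges_on_rest[OF on] ksparse_rest in simp_all)

lemma replace_degree_three:
  assumes "v \<in> V" "card (star E v) = 3" and pq: "p \<in> V - {v}" "q \<in> V - {v}" "p \<noteq> q"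
    and new: "({p, q}, c) \<notin> E" and feas: "feasible V E v p q"
    and blue: "c = Blue \<Longrightarrow> blue_feasible V E v p q"
  shows "tight_limited (V - {v}) (insert ({p, q}, c) (rest E v))"
proof -
  let ?f = "({p, q}, c)"
  have finR: "finite (rest E v)" using finite_E rest_subset by (rule finite_subset[rotated])
  have le: "card (ind (rest E v) W) \<le> card (ind E W)"
    "card (ind (blues (rest E v)) W) \<le> card (ind (blues E) W)" for W
    by (intro card_ind_mono finite_E finite_blues rest_subset blues_mono order_refl)+
  have "?f \<notin> rest E v" using new subsetD[OF rest_subset] by metis
  then have "card (insert ?f (rest E v)) = card (rest E v) + 1" using finR by simp
  then have card0: "card (insert ?f (rest E v)) + 2 = 2 * card (V - {v})"
    using card_star_rest[OF finite_E, of v] card_remove[OF assms(1)] card_E assms(2) by linarith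
  have sp2: "ksparse 2 (V - {v}) (insert ?f (rest E v))"
  proof (rule ksparse_insert_edge[OF finR ksparse_rest(1)])
    fix W assume W: "W \<subseteq> V - {v}" "fst ?f \<subseteq> W"
    then have "card (ind E W) + 3 \<le> 2 * card W" by (intro feasibleD[OF feas W(1)]) simp_all
    then show "card (ind (rest E v) W) + 2 + 1 \<le> 2 * card W" using le(1)[of W] by linarith
  qed
  have sp3: "ksparse 3 (V - {v}) (blues (insert ?f (rest E v)))"
  proof (cases "c = Blue")
    case True
    then have "blues (insert ?f (rest E v)) = insert ?f (blues (rest E v))"
      by (simp add: blues_insert)
    moreover have "ksparse 3 (V - {v}) (insert ?f (blues (rest E v)))"
    proof (rule ksparse_insert_edge[OF _ ksparse_rest(2)])
      fix W assume W: "W \<subseteq> V - {v}" "fst ?f \<subseteq> W"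
      then have "card (ind (blues E) W) + 4 \<le> 2 * card W"
        by (intro blue_feasibleD[OF blue[OF True] W(1)]) simp_all
      then show "card (ind (blues (rest E v)) W) + 3 + 1 \<le> 2 * card W" using le(2)[of W] by linarith
    qed (use finR in simp)
    ultimately show ?thesis by simp
  next
    case False
    then have "blues (insert ?f (rest E v)) = blues (rest E v)" by (simp add: blues_insert)
    then show ?thesis using ksparse_rest(2) by simp
  qed
  have "V - {v} \<noteq> {}" using pq(1) by (metis empty_iff)
  then show ?thesis
    by (rule tight_limited.intro[OF finite_Diff[OF finite_V] _
        edges_on_insertI[OF pq edges_on_rest[OF on]] card0 sp2 sp3])
qed

text \<open>The move forbids a parallel red edge in the smaller graph, whereas \<open>brr\<close>
  speaks of \<open>E\<close>. This is enough: in that colour case the restored edge is blue, so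
  every red edge of the smaller graph is already in \<open>E\<close>.\<close>

lemma reducible_one_extension:
  assumes v: "v \<in> V" and D: "star E v = {({p, v}, c2), ({q, v}, c3), ({s, v}, c)}" and D3: "card (star E v) = 3"
    and V: "p \<in> V - {v}" "q \<in> V - {v}" "s \<in> V - {v}" "p \<noteq> q"
    and new: "({p, q}, c1) \<notin> E" and feas: "feasible V E v p q"
    and blue: "c1 = Blue \<Longrightarrow> blue_feasible V E v p q"
    and rbb: "\<not> colour_case_r_bb c1 c2 c3"
    and brr: "colour_case_b_rr c1 c2 c3 \<Longrightarrow> ({p, q}, Red) \<notin> E"
  shows "reducible V E"
proof -
  let ?f = "({p, q}, c1)" and ?G0 = "\<lparr>verts = V - {v}, edges = insert ({p, q}, c1) (rest E v)\<rparr>"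
  have tl: "tight_limited (V - {v}) (insert ?f (rest E v))"
    using replace_degree_three v D3 V(1,2,4) new feas blue .
  have f: "?f \<notin> rest E v" using new subsetD[OF rest_subset] by metis
  have "\<not> parallel_colour_case_b_rr ?G0 p q c1 c2 c3"
  proof
    assume *: "parallel_colour_case_b_rr ?G0 p q c1 c2 c3"
    then have "({p, q}, Red) \<notin> E" "c1 = Blue"
      using brr unfolding parallel_colour_case_b_rr_def colour_case_b_rr_def by simp_all
    then show False
      using * unfolding parallel_colour_case_b_rr_def by (auto dest: subsetD[OF rest_subset])
  qed
  moreover have "one_extension ?G0 p q c1 v c2 c3 s c \<lparr>verts = V, edges = E\<rparr>"
    unfolding one_extension_def
  proof (intro conjI impI)
    have d: "({p, v}, c2) \<noteq> ({s, v}, c)" "({q, v}, c3) \<noteq> ({s, v}, c)"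
      using card_three_distinct D3[unfolded D] by metis+
    show "c \<noteq> c2" if "s = p" using d that by auto
    show "c \<noteq> c3" if "s = q" using d that by auto
    have "insert ?f (rest E v) - {?f} \<union> {({p, v}, c2), ({q, v}, c3), ({v, s}, c)} = E"
      using f star_Un_rest[of E v] D by (simp add: insert_commute)
    then show "\<lparr>verts = V, edges = E\<rparr> =
      \<lparr>verts = insert v (verts ?G0),
       edges = edges ?G0 - {?f} \<union> {({p, v}, c2), ({q, v}, c3), ({v, s}, c)}\<rparr>"
      using v by (simp add: insert_absorb)
  qed (use V bicoloured_multigraphI[OF tl] in simp_all)
  ultimately have "permitted_one_extension ?G0 \<lparr>verts = V, edges = E\<rparr>"
    using rbb unfolding permitted_one_extension_def by blast
  then show ?thesis
    unfolding reducible_def permitted_move_def using tl card_remove[OF v] by (metis less_add_one)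
qed

lemma star_edge:
  assumes "p \<in> star E v"
  obtains u c where "u \<in> V - {v}" "p = ({u, v}, c)"
proof -
  have p: "p \<in> E" "v \<in> fst p" using assms unfolding star_def by simp_all
  then obtain a b where "a \<in> V" "b \<in> V" "a \<noteq> b" "fst p = {a, b}"
    using bspec[OF on[unfolded edges_on_def] p(1)] by auto
  then obtain u where "u \<in> V - {v}" "fst p = {u, v}" using p(2) by auto
  then show thesis using that[of u "snd p"] by (metis prod.collapse)
qed

lemma reducible_degree_two:
  assumes v: "v \<in> V" and D2: "card (star E v) = 2"
  shows "reducible V E"
proof -
  obtain a b where ab: "star E v = {a, b}" "a \<noteq> b" using D2 card_2_iff by metis
  obtain x c where x: "x \<in> V - {v}" "a = ({x, v}, c)" using star_edge[of a v] ab by auto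
  obtain y d where y: "y \<in> V - {v}" "b = ({y, v}, d)" using star_edge[of b v] ab by auto
  have tl: "tight_limited (V - {v}) (rest E v)"
    using remove_degree_two[OF v D2] x by auto
  have "zero_extension \<lparr>verts = V - {v}, edges = rest E v\<rparr> \<lparr>verts = V, edges = E\<rparr>"
    unfolding zero_extension_def
  proof (intro conjI exI)
    show "x = y \<longrightarrow> c \<noteq> d" using ab(2) x y by auto
    have "rest E v \<union> {({v, x}, c), ({v, y}, d)} = E"
      using star_Un_rest[of E v] ab x y by (simp add: insert_commute)
    then show "\<lparr>verts = V, edges = E\<rparr> =
      \<lparr>verts = insert v (verts \<lparr>verts = V - {v}, edges = rest E v\<rparr>),
       edges = edges \<lparr>verts = V - {v}, edges = rest E v\<rparr> \<union> {({v, x}, c), ({v, y}, d)}\<rparr>"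
      using v by (simp add: insert_absorb)
  qed (use x y bicoloured_multigraphI[OF tl] in simp_all)
  then show ?thesis
    unfolding reducible_def permitted_move_def using tl card_remove[OF v] by (metis less_add_one)
qed

text \<open>If the red edge \<open>pq\<close> is present, it completes a blue-tight set containing \<open>p, q\<close> to a tight set.\<close>

lemma blue_feasible_if_red:
  assumes "feasible V E v p q" "({p, q}, Red) \<in> E"
  shows "blue_feasible V E v p q"
  unfolding blue_feasible_def
proof (intro allI impI)
  fix W assume W: "W \<subseteq> V - {v}" "p \<in> W" "q \<in> W"
  have "insert ({p, q}, Red) (ind (blues E) W) \<subseteq> ind E W"
    using assms(2) W unfolding ind_def blues_def by auto
  then have "card (insert ({p, q}, Red) (ind (blues E) W)) \<le> card (ind E W)"
    using finite_E by (intro card_mono) simp_all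
  moreover have "({p, q}, Red) \<notin> ind (blues E) W" unfolding ind_def blues_def by simp
  ultimately have "card (ind (blues E) W) + 1 \<le> card (ind E W)" using finite_E by simp
  then show "card (ind (blues E) W) + 4 \<le> 2 * card W"
    using feasibleD[OF assms(1) W] by linarith
qed

text \<open>For W = {p, q} the bound reads: number of blue edges plus 4 is at most 4.\<close>

lemma blue_notin_if_blue_feasible:
  assumes "blue_feasible V E v p q" "p \<in> V - {v}" "q \<in> V - {v}"
  shows "({p, q}, Blue) \<notin> E"
proof
  assume "({p, q}, Blue) \<in> E"
  then have "({p, q}, Blue) \<in> ind (blues E) {p, q}" unfolding ind_def blues_def by simp
  then have "card (ind (blues E) {p, q}) > 0"
    using finite_E by (metis card_gt_0_iff empty_iff finite_blues finite_ind)
  moreover have "card (ind (blues E) {p, q}) + 4 \<le> 2 * card {p, q}"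
    using assms(2,3) by (intro blue_feasibleD[OF assms(1)]) simp_all
  moreover have "card {p, q} \<le> 2" by (simp add: card_insert_if)
  ultimately show False by linarith
qed

end

section \<open>A vertex of degree three and the sets that block its neighbours\<close>

locale degree_three = tight_limited +
  fixes v x y z cx cy cz
  assumes v: "v \<in> V"
    and star_v: "star E v = {({x, v}, cx), ({y, v}, cy), ({z, v}, cz)}"
    and degree: "card (star E v) = 3"
begin

text \<open>The three edges at \<open>v\<close> are distinct, but \<open>x\<close>,
  \<open>y\<close>, \<open>z\<close> may coincide. With \<open>rotate\<close> and
  \<open>swap\<close> every case needs treatment for one ordering of the edges only.\<close>

lemma rotate: "degree_three V E v y z x cy cz cx"
  using v star_v degree by unfold_locales (simp_all add: insert_commute)

lemma swap: "degree_three V E v y x z cy cx cz"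
  using v star_v degree by unfold_locales (simp_all add: insert_commute)

lemma nbrs: "x \<in> V - {v}" "y \<in> V - {v}" "z \<in> V - {v}"
proof -
  have E: "({x, v}, cx) \<in> E" "({y, v}, cy) \<in> E" "({z, v}, cz) \<in> E"
    using star_v star_subset[of E v] by simp_all
  show "x \<in> V - {v}" "y \<in> V - {v}" "z \<in> V - {v}"
    using edges_on_ends[OF on E(1)] edges_on_ends[OF on E(2)] edges_on_ends[OF on E(3)] by simp_all
qed

text \<open>Adding \<open>v\<close> to \<open>W\<close> brings in three edges but raises the bound
  only by two, so \<open>W\<close> itself must have one unit to spare beyond sparsity. If the three
  edges are blue, the same holds for the blue count.\<close>

lemma card_ind_nbrs:
  assumes W: "W \<subseteq> V - {v}" "x \<in> W" "y \<in> W" "z \<in> W"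
  shows "card (ind E W) + 3 \<le> 2 * card W"
    and "cx = Blue \<Longrightarrow> cy = Blue \<Longrightarrow> cz = Blue \<Longrightarrow> card (ind (blues E) W) + 4 \<le> 2 * card W"
proof -
  have fW: "finite W" using W(1) finite_V finite_subset by blast
  have vW: "v \<notin> W" using W(1) by blast
  then have cW: "card (insert v W) = card W + 1" using fW by simp
  have sub: "insert v W \<subseteq> V" using W(1) v by blast
  have *: "card (ind F W) + 3 \<le> card (ind F (insert v W))" if F: "F \<subseteq> E" "star E v \<subseteq> F" for F
  proof -
    have finF: "finite F" using F(1) finite_E by (rule finite_subset)
    have "star E v \<subseteq> ind F (insert v W)"
    proof
      fix p assume p: "p \<in> star E v"
      then have "fst p \<subseteq> insert v W" using W(2-4) unfolding star_v by (elim insertE emptyE) simp_all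
      then show "p \<in> ind F (insert v W)" using p F(2) unfolding ind_def by blast
    qed
    moreover have "ind F W \<subseteq> ind F (insert v W)" by (intro ind_mono) auto
    moreover have "ind F W \<inter> star E v = {}" using vW unfolding ind_def star_def by blast
    moreover have fin: "finite (ind F W)" "finite (star E v)" "finite (ind F (insert v W))"
      using finF finite_subset[OF star_subset finite_E] by simp_all
    ultimately have "card (ind F W) + card (star E v) \<le> card (ind F (insert v W))"
      by (metis (no_types) card_Un_disjoint card_mono Un_least)
    then show ?thesis using degree by linarith
  qed
  have "card (ind E (insert v W)) + 2 \<le> 2 * card (insert v W)"
    by (rule ksparse_2D[OF sparse2 finite_V sub]) simp
  then show "card (ind E W) + 3 \<le> 2 * card W" using *[OF order_refl star_subset] cW by linarith
  assume b: "cx = Blue" "cy = Blue" "cz = Blue"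
  have "star E v \<subseteq> blues E"
  proof
    fix p assume p: "p \<in> star E v"
    then have "snd p = Blue" unfolding star_v by (elim insertE emptyE) (simp_all add: b)
    then show "p \<in> blues E" using subsetD[OF star_subset p] unfolding blues_def by simp
  qed
  from *[OF blues_subset this] have "card (ind (blues E) W) + 3 \<le> card (ind (blues E) (insert v W))" .
  moreover have "card W > 0" using fW W(2) by (metis card_gt_0_iff empty_iff)
  then have "card (ind (blues E) (insert v W)) + 3 \<le> 2 * card (insert v W)"
    using cW by (intro ksparse_3D[OF blue_sparse sub]) simp
  ultimately show "card (ind (blues E) W) + 4 \<le> 2 * card W" using cW by linarith
qed

lemma not_feasibleE:
  assumes "\<not> feasible V E v p q"
  obtains W where "W \<subseteq> V - {v}" "p \<in> W" "q \<in> W" "2 * card W \<le> card (ind E W) + 2"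
proof -
  from assms obtain W where "W \<subseteq> V - {v}" "p \<in> W" "q \<in> W" "\<not> card (ind E W) + 3 \<le> 2 * card W"
    unfolding feasible_def by metis
  then show thesis by (intro that[of W]) simp_all
qed

lemma not_blue_feasibleE:
  assumes "\<not> blue_feasible V E v p q"
  obtains W where "W \<subseteq> V - {v}" "p \<in> W" "q \<in> W" "2 * card W \<le> card (ind (blues E) W) + 3"
proof -
  from assms obtain W where "W \<subseteq> V - {v}" "p \<in> W" "q \<in> W" "\<not> card (ind (blues E) W) + 4 \<le> 2 * card W"
    unfolding blue_feasible_def by metis
  then show thesis by (intro that[of W]) simp_all
qed

lemma feasible_alternative: "feasible V E v x y \<or> feasible V E v x z"
proof (rule ccontr)
  assume "\<not> ?thesis"
  then have n: "\<not> feasible V E v x y" "\<not> feasible V E v x z" by simp_all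
  obtain W where W: "W \<subseteq> V - {v}" "x \<in> W" "y \<in> W" "2 * card W \<le> card (ind E W) + 2"
    using n(1) by (rule not_feasibleE)
  obtain U where U: "U \<subseteq> V - {v}" "x \<in> U" "z \<in> U" "2 * card U \<le> card (ind E U) + 2"
    using n(2) by (rule not_feasibleE)
  have fin: "finite W" "finite U" using W(1) U(1) finite_V finite_subset by blast+
  \<comment> \<open>The intersection contains \<open>x\<close>, which suffices for the bound with 2.
    The two blocking sets miss their bounds by 2 + 2 at most, while union and intersection must miss
    by 3 + 2.\<close>
  have "card (ind E (W \<inter> U)) + 2 \<le> 2 * card (W \<inter> U)"
    by (rule ksparse_2D[OF sparse2 finite_V]) (use W U in blast)+
  moreover have "card (ind E (W \<union> U)) + 3 \<le> 2 * card (W \<union> U)"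
    using W U by (intro card_ind_nbrs(1)) simp_all
  moreover have "card W + card U = card (W \<union> U) + card (W \<inter> U)" using fin by (rule card_Un_Int)
  ultimately show False
    using card_ind_supermodular[OF finite_E, of W U] W(4) U(4) by linarith
qed

text \<open>Replacement edges of different colours fall under neither excluded case, so the restored
  edge may have any colour. Red needs only \<open>feasible\<close>; if the red edge is already
  there, its presence yields \<open>blue_feasible\<close>, which also shows that the blue edge is
  free.\<close>

lemma reducible_mixed:
  assumes "x \<noteq> y" "cx \<noteq> cy" "feasible V E v x y"
  shows "reducible V E"
proof -
  obtain c1 where c1: "({x, y}, c1) \<notin> E" "c1 = Blue \<Longrightarrow> blue_feasible V E v x y"
  proof (cases "({x, y}, Red) \<in> E")
    case False
    then show ?thesis by (intro that[of Red]) simp_all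
  next
    case True
    then have b: "blue_feasible V E v x y" by (rule blue_feasible_if_red[OF assms(3)])
    show ?thesis by (rule that[OF blue_notin_if_blue_feasible[OF b nbrs(1,2)] b])
  qed
  show ?thesis
    by (rule reducible_one_extension[OF v star_v degree nbrs assms(1) c1(1) assms(3) c1(2)])
      (use assms(2) in \<open>auto simp: colour_case_r_bb_def colour_case_b_rr_def\<close>)
qed

lemma reducible_red_red:
  assumes "x \<noteq> y" "cx = Red" "cy = Red" "feasible V E v x y" "({x, y}, Red) \<notin> E"
  shows "reducible V E"
  by (rule reducible_one_extension[OF v star_v degree nbrs assms(1,5,4)])
    (use assms in \<open>simp_all add: colour_case_r_bb_def colour_case_b_rr_def\<close>)

text \<open>Merging two blue edges into a red one would be the excluded case \<open>r\<close> to
  \<open>{b,b}\<close>, so the restored edge has to be blue and both kinds of blocking set must be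
  absent.\<close>

lemma reducible_blue_blue:
  assumes "x \<noteq> y" "cx = Blue" "cy = Blue" "feasible V E v x y" "blue_feasible V E v x y"
  shows "reducible V E"
  by (rule reducible_one_extension[OF v star_v degree nbrs assms(1)
        blue_notin_if_blue_feasible[OF assms(5) nbrs(1,2)] assms(4,5)])
    (use assms in \<open>simp_all add: colour_case_r_bb_def colour_case_b_rr_def\<close>)

end

section \<open>Three blue edges, doubled neighbours and two colours\<close>

lemma feasible_sym: "feasible V E v p q = feasible V E v q p"
  unfolding feasible_def by metis

lemma ternary_colour: "(a :: colour) \<noteq> b \<Longrightarrow> c = a \<or> c = b"
  by (metis colour.exhaust)

text \<open>Inclusion-exclusion for three sets with empty triple intersection. The summand 1 is the
  vertex \<open>z\<close>, shared by \<open>W2\<close> and \<open>W3\<close>; a single vertex spans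
  no edge, so the edge count has no matching term. This surplus of two on the vertex side gives the
  contradictions below, once with \<open>F = E\<close> and once with \<open>F\<close> the blue
  edges.\<close>

lemma three_cover:
  assumes "finite F" "B \<subseteq> F" "edges_on V B" "finite W1" "finite W2" "finite W3"
    and meet: "W2 \<inter> W3 = {z}" "z \<notin> W1"
  shows "card (ind F W1) + card (ind B W2) + card (ind B W3) \<le>
      card (ind F (W1 \<union> (W2 \<union> W3))) + card (ind B (W1 \<inter> W2)) + card (ind B (W1 \<inter> W3))"
    and "card W1 + card W2 + card W3 =
      card (W1 \<union> (W2 \<union> W3)) + card (W1 \<inter> W2) + card (W1 \<inter> W3) + 1"
proof -
  let ?A = "ind F W1" and ?C = "ind B W2 \<union> ind B W3"
  have finB: "finite B" using assms(2,1) by (rule finite_subset)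
  have "ind B W2 \<inter> ind B W3 = {}"
    unfolding ind_Int meet by (rule ind_eq_emptyI[OF assms(3)]) simp_all
  then have "card ?C = card (ind B W2) + card (ind B W3)" using finB by (simp add: card_Un_disjoint)
  moreover have "card ?A + card ?C = card (?A \<union> ?C) + card (?A \<inter> ?C)"
    using assms(1) finB by (intro card_Un_Int) simp_all
  moreover have "?A \<union> ?C \<subseteq> ind F (W1 \<union> (W2 \<union> W3))"
    using assms(2) unfolding ind_def by auto
  then have "card (?A \<union> ?C) \<le> card (ind F (W1 \<union> (W2 \<union> W3)))" using assms(1) by (intro card_mono) simp_all
  moreover have "?A \<inter> ?C \<subseteq> ind B (W1 \<inter> W2) \<union> ind B (W1 \<inter> W3)" unfolding ind_def by auto
  then have "card (?A \<inter> ?C) \<le> card (ind B (W1 \<inter> W2) \<union> ind B (W1 \<inter> W3))"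
    using finB by (intro card_mono) simp_all
  moreover have "\<dots> \<le> card (ind B (W1 \<inter> W2)) + card (ind B (W1 \<inter> W3))" by (rule card_Un_le)
  ultimately show "card (ind F W1) + card (ind B W2) + card (ind B W3) \<le>
      card (ind F (W1 \<union> (W2 \<union> W3))) + card (ind B (W1 \<inter> W2)) + card (ind B (W1 \<inter> W3))" by linarith
  have "card W2 + card W3 = card (W2 \<union> W3) + card (W2 \<inter> W3)" using assms(5,6) by (rule card_Un_Int)
  moreover have "card (W2 \<inter> W3) = 1" unfolding meet by simp
  moreover have "card W1 + card (W2 \<union> W3) = card (W1 \<union> (W2 \<union> W3)) + card (W1 \<inter> (W2 \<union> W3))"
    using assms(4-6) by (intro card_Un_Int) simp_all
  moreover have "card (W1 \<inter> (W2 \<union> W3)) = card (W1 \<inter> W2) + card (W1 \<inter> W3)"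
    unfolding Int_Un_distrib using assms(4) meet by (intro card_Un_disjoint) auto
  ultimately show "card W1 + card W2 + card W3 =
      card (W1 \<union> (W2 \<union> W3)) + card (W1 \<inter> W2) + card (W1 \<inter> W3) + 1" by linarith
qed

context degree_three
begin

text \<open>With a second common vertex the intersection obeys the blue bound, and uncrossing gives
  a blue-tight union containing all three neighbours, against \<open>card_ind_nbrs\<close>.\<close>

lemma blue_tight_meet:
  assumes b: "cx = Blue" "cy = Blue" "cz = Blue"
    and W: "W \<subseteq> V - {v}" "y \<in> W" "z \<in> W" "2 * card W \<le> card (ind (blues E) W) + 3"
    and U: "U \<subseteq> V - {v}" "z \<in> U" "x \<in> U" "2 * card U \<le> card (ind (blues E) U) + 3"
  shows "W \<inter> U = {z}"
proof (rule ccontr)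
  assume ne: "W \<inter> U \<noteq> {z}"
  have fin: "finite W" "finite U" using W(1) U(1) finite_V finite_subset by blast+
  obtain u where "u \<in> W \<inter> U" "u \<noteq> z" using ne W(3) U(2) by blast
  then have "card {u, z} \<le> card (W \<inter> U)" using W(3) U(2) fin by (intro card_mono) simp_all
  then have "2 \<le> card (W \<inter> U)" using \<open>u \<noteq> z\<close> by simp
  then have "card (ind (blues E) (W \<inter> U)) + 3 \<le> 2 * card (W \<inter> U)"
    using W(1) by (intro ksparse_3D[OF blue_sparse]) auto
  moreover have "card (ind (blues E) (W \<union> U)) + 4 \<le> 2 * card (W \<union> U)"
    using W U b by (intro card_ind_nbrs(2)) simp_all
  moreover have "card W + card U = card (W \<union> U) + card (W \<inter> U)" using fin by (rule card_Un_Int)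
  ultimately show False
    using card_ind_supermodular[OF finite_blues[OF finite_E], of W U] W(4) U(4) by linarith
qed

text \<open>The three sets miss 2|W| by at most 2 + 3 + 3 = 8. The union and the two intersections
  with \<open>W1\<close> must miss theirs by 3 + 2 + 2 = 7, and the doubly counted \<open>z\<close>
  adds 2, which makes 9. The intersections may be single vertices, so only the bound with 2 is used
  for them.\<close>

lemma tight_blue_blue:
  assumes b: "cx = Blue" "cy = Blue" "cz = Blue"
    and n: "\<not> feasible V E v x y" "\<not> blue_feasible V E v y z" "\<not> blue_feasible V E v z x"
  shows False
proof -
  obtain W1 where W1: "W1 \<subseteq> V - {v}" "x \<in> W1" "y \<in> W1" "2 * card W1 \<le> card (ind E W1) + 2"
    using n(1) by (rule not_feasibleE)
  obtain W2 where W2: "W2 \<subseteq> V - {v}" "y \<in> W2" "z \<in> W2" "2 * card W2 \<le> card (ind (blues E) W2) + 3"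
    using n(2) by (rule not_blue_feasibleE)
  obtain W3 where W3: "W3 \<subseteq> V - {v}" "z \<in> W3" "x \<in> W3" "2 * card W3 \<le> card (ind (blues E) W3) + 3"
    using n(3) by (rule not_blue_feasibleE)
  have meet: "W2 \<inter> W3 = {z}" by (rule blue_tight_meet[OF b W2 W3])
  have z: "z \<notin> W1"
  proof
    assume "z \<in> W1"
    with card_ind_nbrs(1)[OF W1(1-3)] W1(4) show False by linarith
  qed
  have fin: "finite W1" "finite W2" "finite W3"
    using W1(1) W2(1) W3(1) finite_V finite_subset by blast+
  have le: "card (ind (blues E) W) + 2 \<le> 2 * card W" if "W \<subseteq> V" "W \<noteq> {}" for W
    using ksparse_2D[OF sparse2 finite_V that] card_ind_mono[OF finite_E blues_subset order_refl, of W]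
    by linarith
  have "card (ind (blues E) (W1 \<inter> W2)) + 2 \<le> 2 * card (W1 \<inter> W2)"
    using W1(1,3) W2(2) by (intro le) blast+
  moreover have "card (ind (blues E) (W1 \<inter> W3)) + 2 \<le> 2 * card (W1 \<inter> W3)"
    using W1(1,2) W3(3) by (intro le) blast+
  moreover have "card (ind E (W1 \<union> (W2 \<union> W3))) + 3 \<le> 2 * card (W1 \<union> (W2 \<union> W3))"
    using W1 W2 W3 by (intro card_ind_nbrs(1)) simp_all
  ultimately show False
    using three_cover[OF finite_E blues_subset edges_on_blues[OF on] fin meet z] W1(4) W2(4) W3(4)
    by linarith
qed

text \<open>The sets meet pairwise in single vertices, which span no edge. They miss 2|W| by at most
  9 in total, while the union must miss by 4 and the three shared vertices contribute 6.\<close>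

lemma blue_blue_blue:
  assumes b: "cx = Blue" "cy = Blue" "cz = Blue"
    and n: "\<not> blue_feasible V E v x y" "\<not> blue_feasible V E v y z" "\<not> blue_feasible V E v z x"
  shows False
proof -
  interpret r1: degree_three V E v y z x cy cz cx by (rule rotate)
  interpret r2: degree_three V E v z x y cz cx cy by (rule r1.rotate)
  obtain W1 where W1: "W1 \<subseteq> V - {v}" "x \<in> W1" "y \<in> W1" "2 * card W1 \<le> card (ind (blues E) W1) + 3"
    using n(1) by (rule not_blue_feasibleE)
  obtain W2 where W2: "W2 \<subseteq> V - {v}" "y \<in> W2" "z \<in> W2" "2 * card W2 \<le> card (ind (blues E) W2) + 3"
    using n(2) by (rule not_blue_feasibleE)
  obtain W3 where W3: "W3 \<subseteq> V - {v}" "z \<in> W3" "x \<in> W3" "2 * card W3 \<le> card (ind (blues E) W3) + 3"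
    using n(3) by (rule not_blue_feasibleE)
  have meet: "W2 \<inter> W3 = {z}" by (rule blue_tight_meet[OF b W2 W3])
  have z: "z \<notin> W1"
  proof
    assume "z \<in> W1"
    with card_ind_nbrs(2)[OF W1(1-3) _ b] W1(4) show False by linarith
  qed
  have fin: "finite W1" "finite W2" "finite W3"
    using W1(1) W2(1) W3(1) finite_V finite_subset by blast+
  have "W1 \<inter> W2 = {y}" "W1 \<inter> W3 = {x}"
    using r2.blue_tight_meet[OF b(3,1,2) W1 W2] r1.blue_tight_meet[OF b(2,3,1) W3 W1] by blast+
  then have "ind (blues E) (W1 \<inter> W2) = {}" "ind (blues E) (W1 \<inter> W3) = {}"
    "card (W1 \<inter> W2) = 1" "card (W1 \<inter> W3) = 1"
    using ind_eq_emptyI[OF edges_on_blues[OF on], of "{x}"]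
      ind_eq_emptyI[OF edges_on_blues[OF on], of "{y}"] by simp_all
  then have "card (ind (blues E) (W1 \<inter> W2)) = 0" "card (ind (blues E) (W1 \<inter> W3)) = 0"
    "card (W1 \<inter> W2) = 1" "card (W1 \<inter> W3) = 1" by simp_all
  moreover have "card (ind (blues E) (W1 \<union> (W2 \<union> W3))) + 4 \<le> 2 * card (W1 \<union> (W2 \<union> W3))"
    using W1 W2 W3 b by (intro card_ind_nbrs(2)) simp_all
  ultimately show False
    using three_cover[OF finite_blues[OF finite_E] order_refl edges_on_blues[OF on] fin meet z]
      W1(4) W2(4) W3(4)
    by linarith
qed

lemma edges_distinct:
  "({x, v}, cx) \<noteq> ({y, v}, cy)" "({x, v}, cx) \<noteq> ({z, v}, cz)" "({y, v}, cy) \<noteq> ({z, v}, cz)"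
  using card_three_distinct[OF degree[unfolded star_v]] by simp_all

text \<open>A set containing \<open>x\<close> and \<open>y\<close> contains all neighbours, so the
  pair is never blocked. The parallel edges at \<open>x\<close> have different colours, so one of
  them differs from the edge at \<open>y\<close>; that one is merged with it and the other serves as
  connecting edge.\<close>

lemma reducible_doubled:
  assumes "x = z"
  shows "reducible V E"
proof -
  have c: "cx \<noteq> cz" using edges_distinct(2) assms by simp
  have xy: "x \<noteq> y"
  proof
    assume "x = y"
    then have "cx \<noteq> cy" "cy \<noteq> cz" using edges_distinct(1,3) assms by simp_all
    then show False using c ternary_colour by metis
  qed
  have f: "feasible V E v x y"
    unfolding feasible_def using card_ind_nbrs(1) assms by simp
  show ?thesis
  proof (cases "cx = cy")
    case False
    then show ?thesis using reducible_mixed xy f by simp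
  next
    case True
    interpret r: degree_three V E v z y x cz cy cx
      by (rule degree_three.swap[OF rotate])
    show ?thesis using r.reducible_mixed xy f True c assms by simp
  qed
qed

text \<open>Here \<open>x\<close> carries the colour occurring once, so both pairs through
  \<open>x\<close> are mixed, and one of them is unblocked.\<close>

lemma reducible_two_colours:
  assumes "x \<noteq> y" "x \<noteq> z" "cx \<noteq> cy" "cx \<noteq> cz"
  shows "reducible V E"
proof -
  interpret r: degree_three V E v x z y cx cz cy
    using degree_three.swap[OF degree_three.rotate[OF rotate]] .
  show ?thesis using feasible_alternative reducible_mixed r.reducible_mixed assms by metis
qed

lemma reducible_all_blue:
  assumes d: "x \<noteq> y" "y \<noteq> z" "x \<noteq> z" and b: "cx = Blue" "cy = Blue" "cz = Blue"
  shows "reducible V E"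
proof (rule ccontr)
  assume nr: "\<not> reducible V E"
  interpret r1: degree_three V E v y z x cy cz cx by (rule rotate)
  interpret r2: degree_three V E v z x y cz cx cy by (rule r1.rotate)
  have pairs: "\<not> feasible V E v x y \<or> \<not> blue_feasible V E v x y"
    "\<not> feasible V E v y z \<or> \<not> blue_feasible V E v y z"
    "\<not> feasible V E v z x \<or> \<not> blue_feasible V E v z x"
    using reducible_blue_blue r1.reducible_blue_blue r2.reducible_blue_blue d b nr by metis+
  have alts: "feasible V E v x y \<or> feasible V E v z x" "feasible V E v y z \<or> feasible V E v x y"
    "feasible V E v z x \<or> feasible V E v y z"
    using feasible_alternative r1.feasible_alternative r2.feasible_alternative feasible_sym by metis+
  \<comment> \<open>At most one pair is blocked by a tight set, so the other pairs are blocked by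
    blue-tight sets: either exactly two pairs are of this kind, beside a tight set for the third, or
    all three are.\<close>
  consider "\<not> feasible V E v x y" "\<not> blue_feasible V E v y z" "\<not> blue_feasible V E v z x"
    | "\<not> feasible V E v y z" "\<not> blue_feasible V E v z x" "\<not> blue_feasible V E v x y"
    | "\<not> feasible V E v z x" "\<not> blue_feasible V E v x y" "\<not> blue_feasible V E v y z"
    | "\<not> blue_feasible V E v x y" "\<not> blue_feasible V E v y z" "\<not> blue_feasible V E v z x"
    using pairs alts by metis
  then show False
    by cases (metis tight_blue_blue r1.tight_blue_blue r2.tight_blue_blue b blue_blue_blue)+
qed

end

section \<open>Three red edges and the red K4\<close>

context degree_three
begin

text \<open>A tight set through \<open>x\<close> and \<open>y\<close> that misses \<open>z\<close>
  stays tight when \<open>z\<close> is added, since the two red edges pay for the vertex. It would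
  then contain all neighbours.\<close>

lemma feasible_if_red_red:
  assumes "z \<noteq> x" "z \<noteq> y" "x \<noteq> y" "({x, z}, Red) \<in> E" "({y, z}, Red) \<in> E"
  shows "feasible V E v x y"
proof (rule ccontr)
  assume "\<not> ?thesis"
  then obtain W where W: "W \<subseteq> V - {v}" "x \<in> W" "y \<in> W" "2 * card W \<le> card (ind E W) + 2"
    by (rule not_feasibleE)
  have fW: "finite W" using W(1) finite_V finite_subset by blast
  have z: "z \<notin> W"
  proof
    assume "z \<in> W"
    with card_ind_nbrs(1)[OF W(1-3)] W(4) show False by linarith
  qed
  let ?T = "{({x, z}, Red), ({y, z}, Red)}"
  have T: "card ?T = 2" using assms by (simp add: doubleton_eq_iff)
  have disj: "ind E W \<inter> ?T = {}" using z unfolding ind_def by simp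
  have "ind E W \<union> ?T \<subseteq> ind E (insert z W)"
    using W(2,3) assms(4,5) unfolding ind_def by auto
  then have "card (ind E W \<union> ?T) \<le> card (ind E (insert z W))"
    using finite_E by (intro card_mono) simp_all
  moreover have "card (ind E W \<union> ?T) = card (ind E W) + card ?T"
    by (rule card_Un_disjoint[OF _ _ disj]) (simp_all add: finite_E)
  moreover have "card (ind E (insert z W)) + 3 \<le> 2 * card (insert z W)"
    using W nbrs(3) by (intro card_ind_nbrs(1)) simp_all
  ultimately show False using T W(4) z fW by simp
qed

lemma reducible_red_K4:
  assumes d: "x \<noteq> y" "y \<noteq> z" "x \<noteq> z" and r: "cx = Red" "cy = Red" "cz = Red"
    and T: "({x, y}, Red) \<in> E" "({x, z}, Red) \<in> E" "({y, z}, Red) \<in> E"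
  shows "reducible V E"
proof -
  define T where "T = {({x, y}, Red), ({x, z}, Red), ({y, z}, Red)}"
  define F where "F = {({x, y}, Blue), ({x, y}, Red), ({y, z}, Blue), ({y, z}, Red)}"
  define R where "R = rest E v - T"
  let ?N = "{x, y, z}"
  have vN: "v \<noteq> x" "v \<noteq> y" "v \<noteq> z" and NV: "?N \<subseteq> V - {v}" using nbrs by auto
  have T3: "card T = 3" and F4: "card F = 4" and finT: "finite T" and finF: "finite F"
    using d unfolding T_def F_def by (auto simp: card_insert_if doubleton_eq_iff)
  have TE: "T \<subseteq> rest E v" using T vN unfolding T_def rest_def by simp
  have RE: "R \<subseteq> E" unfolding R_def rest_def by fast
  have finR: "finite R" using RE finite_E by (rule finite_subset)
  \<comment> \<open>The red K4 on \<open>v\<close> and its neighbours is tight, with six edges on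
    four vertices. Joining it to \<open>W\<close> leaves for the edges of \<open>R\<close> at most
    two units per vertex of \<open>W\<close> outside the K4.\<close>
  have sup: "card (ind R W) \<le> 2 * card (W - ?N)" if W: "W \<subseteq> V - {v}" for W
  proof -
    let ?U = "W \<union> insert v ?N"
    have fW: "finite W" using W finite_V finite_subset by blast
    have U: "?U \<subseteq> V" using W NV v by blast
    have "?U = (W - ?N) \<union> insert v ?N" by blast
    also have "card \<dots> = card (W - ?N) + card (insert v ?N)"
      using W fW by (intro card_Un_disjoint) auto
    also have "card (insert v ?N) = 4" using d vN by simp
    finally have cU: "card ?U = card (W - ?N) + 4" .
    have sub: "ind R W \<union> (T \<union> star E v) \<subseteq> ind E ?U"
    proof (intro Un_least)
      show "ind R W \<subseteq> ind E ?U" by (intro ind_mono RE Un_upper1)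
      show "T \<subseteq> ind E ?U" using T unfolding T_def ind_def by simp
      show "star E v \<subseteq> ind E ?U" using star_subset[of E v] unfolding star_v ind_def by simp
    qed
    have fS: "finite (star E v)" using star_subset finite_E by (rule finite_subset)
    have "T \<inter> star E v = {}" using TE star_Int_rest[of E v] by blast
    then have "card (T \<union> star E v) = 6" using T3 degree finT fS by (simp add: card_Un_disjoint)
    moreover have "ind R W \<inter> (T \<union> star E v) = {}"
      using ind_subset[of R W] star_Int_rest[of E v] unfolding R_def by blast
    then have "card (ind R W \<union> (T \<union> star E v)) = card (ind R W) + card (T \<union> star E v)"
      using finR finT fS by (intro card_Un_disjoint) simp_all
    moreover have "card (ind R W \<union> (T \<union> star E v)) \<le> card (ind E ?U)"
      using finite_E by (intro card_mono sub) simp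
    moreover have "card (ind E ?U) + 2 \<le> 2 * card ?U"
      by (rule ksparse_2D[OF sparse2 finite_V U]) simp
    ultimately show ?thesis using cU by linarith
  qed
  \<comment> \<open>For \<open>W = ?N\<close> the bound \<open>sup\<close> is zero: the neighbours
    span no edge besides the red triangle, so the four edges of \<open>F\<close> are really
    new.\<close>
  have RF: "R \<inter> F = {}"
  proof -
    have "card (ind R ?N) = 0" using sup[OF NV] by simp
    then have "ind R ?N = {}" using finR by simp
    moreover have "F \<subseteq> ind F ?N" unfolding F_def ind_def by simp
    ultimately show ?thesis unfolding ind_def by blast
  qed
  have cards: "card (W - ?N) + card (W \<inter> ?N) = card W" if "finite W" for W
    using that by (metis Int_Diff_Un Int_Diff_disjoint add.commute card_Un_disjoint finite_Diff finite_Int)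
  \<comment> \<open>If \<open>W\<close> contains j = 2 or 3 neighbours, \<open>F\<close> contributes
    at most 2(j - 1) edges, at most j - 1 of them blue. Together with \<open>sup\<close> this gives
    2|W| - 2 in total and at most 2|W| - 3 in blue.\<close>
  have F_cases: "ind F W = {} \<or>
      card (ind F W) \<le> 2 \<and> card (ind (blues F) W) \<le> 1 \<and> card (W \<inter> ?N) = 2 \<or>
      card (ind F W) \<le> 4 \<and> card (ind (blues F) W) \<le> 2 \<and> card (W \<inter> ?N) = 3" for W
  proof -
    have bF: "blues F = {({x, y}, Blue), ({y, z}, Blue)}" unfolding F_def by (simp add: blues_insert) (simp add: blues_def)
    consider "y \<notin> W \<or> x \<notin> W \<and> z \<notin> W" | "x \<in> W" "y \<in> W" "z \<notin> W" | "x \<notin> W" "y \<in> W" "z \<in> W"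
      | "x \<in> W" "y \<in> W" "z \<in> W" by metis
    then show ?thesis
    proof cases
      case 1
      then have "ind F W = {}" unfolding ind_def F_def by auto
      then show ?thesis by simp
    next
      case 2
      then have "ind F W = {({x, y}, Blue), ({x, y}, Red)}" "ind (blues F) W = {({x, y}, Blue)}"
        "W \<inter> ?N = {x, y}" unfolding bF ind_def by (auto simp: F_def)
      then show ?thesis using d by simp
    next
      case 3
      then have "ind F W = {({y, z}, Blue), ({y, z}, Red)}" "ind (blues F) W = {({y, z}, Blue)}"
        "W \<inter> ?N = {y, z}" unfolding bF ind_def by (auto simp: F_def)
      then show ?thesis using d by simp
    next
      case 4
      have "card (ind F W) \<le> card F" "card (ind (blues F) W) \<le> card (blues F)"
        using finF by (intro card_mono ind_subset; simp)+
      moreover have "card (blues F) \<le> 2" unfolding bF by (simp add: card_insert_if)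
      moreover have "W \<inter> ?N = ?N" using 4 by blast
      ultimately show ?thesis using d F4 by simp
    qed
  qed
  have sp2: "ksparse 2 (V - {v}) (R \<union> F)"
    unfolding ksparse_def
  proof (intro allI impI)
    fix W assume W: "W \<subseteq> V - {v}" "ind (R \<union> F) W \<noteq> {}"
    have fW: "finite W" using W(1) finite_V finite_subset by blast
    have le: "card (ind (R \<union> F) W) \<le> card (ind R W) + card (ind F W)" unfolding ind_Un by (rule card_Un_le)
    show "card (ind (R \<union> F) W) + 2 \<le> 2 * card W"
    proof (cases "ind F W = {}")
      case True
      then have ne: "ind R W \<noteq> {}" "card (ind (R \<union> F) W) = card (ind R W)" using W(2) unfolding ind_Un by simp_all
      have "ksparse 2 (V - {v}) R"
        using ksparse_mono[OF sparse2 on RE _ finite_V] finite_V by simp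
      then show ?thesis using W(1) ne unfolding ksparse_def by simp
    next
      case False
      then show ?thesis using F_cases[of W] le sup[OF W(1)] cards[OF fW] by (elim disjE) simp_all
    qed
  qed
  have sp3: "ksparse 3 (V - {v}) (blues (R \<union> F))"
    unfolding ksparse_def blues_Un
  proof (intro allI impI)
    fix W assume W: "W \<subseteq> V - {v}" "ind (blues R \<union> blues F) W \<noteq> {}"
    have fW: "finite W" using W(1) finite_V finite_subset by blast
    have le: "card (ind (blues R \<union> blues F) W) \<le> card (ind (blues R) W) + card (ind (blues F) W)"
      unfolding ind_Un by (rule card_Un_le)
    have leR: "card (ind (blues R) W) \<le> card (ind R W)"
      by (intro card_ind_mono finR blues_subset order_refl)
    show "card (ind (blues R \<union> blues F) W) + 3 \<le> 2 * card W"
    proof (cases "ind F W = {}")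
      case True
      then have "ind (blues F) W = {}" unfolding ind_def blues_def by blast
      then have ne: "ind (blues R) W \<noteq> {}" "card (ind (blues R \<union> blues F) W) = card (ind (blues R) W)"
        using W(2) unfolding ind_Un by simp_all
      have "ksparse 3 (V - {v}) (blues R)"
        using ksparse_mono[OF blue_sparse edges_on_blues[OF on] blues_mono[OF RE] _ finite_V] finite_V by simp
      then show ?thesis using W(1) ne unfolding ksparse_def by simp
    next
      case False
      then show ?thesis using F_cases[of W] le leR sup[OF W(1)] cards[OF fW] by (elim disjE) simp_all
    qed
  qed
  have onR: "edges_on (V - {v}) R"
    by (rule edges_on_mono[OF edges_on_rest[OF on] order_refl]) (simp add: R_def)
  have onF: "edges_on (V - {v}) F"
    unfolding F_def by (intro edges_on_insertI edges_on_empty nbrs d)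
  have "card R + 3 = card (rest E v)"
    using card_Diff_subset[OF finT TE] card_mono[OF _ TE] finite_subset[OF rest_subset finite_E] T3
    unfolding R_def by simp
  moreover have "card (R \<union> F) = card R + card F" using finR finF RF by (rule card_Un_disjoint)
  ultimately have card0: "card (R \<union> F) + 2 = 2 * card (V - {v})"
    using card_star_rest[OF finite_E, of v] degree F4 card_remove[OF v] card_E by linarith
  have "V - {v} \<noteq> {}" using nbrs(1) by (metis empty_iff)
  then have tl: "tight_limited (V - {v}) (R \<union> F)"
    using finite_V onR onF card0 sp2 sp3 by (intro tight_limited.intro) (simp_all add: edges_on_Un)
  let ?G0 = "\<lparr>verts = V - {v}, edges = R \<union> F\<rparr>"
  have "K2K2_substitution ?G0 \<lparr>verts = V, edges = E\<rparr>"
    unfolding K2K2_substitution_def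
  proof (intro conjI exI)
    show "distinct [x, y, z]" using d by simp
    show "{({x, y}, Blue), ({x, y}, Red), ({y, z}, Blue), ({y, z}, Red)} \<subseteq> edges ?G0"
      unfolding F_def by simp
    have "({x, z}, Red) \<notin> F" using d unfolding F_def by (simp add: doubleton_eq_iff)
    moreover have "({x, z}, Red) \<notin> R" unfolding R_def T_def by simp
    ultimately show "({x, z}, Red) \<notin> edges ?G0" by simp
    have "R \<union> F - F = R" using RF by blast
    moreover have "R \<union> (T \<union> star E v) = E" using TE star_Un_rest[of E v] unfolding R_def by blast
    ultimately have "(R \<union> F - F) \<union> (T \<union> star E v) = E" by simp
    moreover have "T \<union> star E v = {({x, y}, Red), ({x, z}, Red), ({y, z}, Red),
      ({x, v}, Red), ({y, v}, Red), ({z, v}, Red)}"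
      unfolding T_def star_v r by (simp only: Un_insert_left Un_empty_left)
    ultimately show "\<lparr>verts = V, edges = E\<rparr> = \<lparr>verts = insert v (verts ?G0),
      edges = edges ?G0 - {({x, y}, Blue), ({x, y}, Red), ({y, z}, Blue), ({y, z}, Red)} \<union>
        {({x, y}, Red), ({x, z}, Red), ({y, z}, Red), ({x, v}, Red), ({y, v}, Red), ({z, v}, Red)}\<rparr>"
      using v unfolding F_def by (simp add: insert_absorb)
  qed (use bicoloured_multigraphI[OF tl] NV in simp_all)
  then show ?thesis
    unfolding reducible_def permitted_move_def using tl card_remove[OF v] by (metis less_add_one)
qed

text \<open>Two pairs are unblocked; without a reduction their red edges are present. These share a
  neighbour, so \<open>feasible_if_red_red\<close> unblocks the third pair too, and its red edge
  completes the K4.\<close>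

lemma reducible_all_red:
  assumes d: "x \<noteq> y" "y \<noteq> z" "x \<noteq> z" and r: "cx = Red" "cy = Red" "cz = Red"
  shows "reducible V E"
proof (rule ccontr)
  assume nr: "\<not> reducible V E"
  interpret r1: degree_three V E v y z x cy cz cx by (rule rotate)
  interpret r2: degree_three V E v z x y cz cx cy by (rule r1.rotate)
  have e: "feasible V E v x y \<Longrightarrow> ({x, y}, Red) \<in> E" "feasible V E v y z \<Longrightarrow> ({y, z}, Red) \<in> E"
    "feasible V E v z x \<Longrightarrow> ({x, z}, Red) \<in> E"
    using reducible_red_red r1.reducible_red_red r2.reducible_red_red d r nr insert_commute[of x z] by metis+
  have alts: "feasible V E v x y \<or> feasible V E v z x" "feasible V E v y z \<or> feasible V E v x y"
    "feasible V E v z x \<or> feasible V E v y z"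
    using feasible_alternative r1.feasible_alternative r2.feasible_alternative feasible_sym by metis+
  have f: "feasible V E v x y" "feasible V E v y z" "feasible V E v z x"
    using alts e feasible_if_red_red r1.feasible_if_red_red r2.feasible_if_red_red d
      insert_commute[of x z] insert_commute[of x y] insert_commute[of y z] by metis+
  show False using reducible_red_K4[OF d r] e f nr by simp
qed

lemma reducible_degree_three: "reducible V E"
proof -
  interpret r1: degree_three V E v y z x cy cz cx by (rule rotate)
  interpret r2: degree_three V E v z x y cz cx cy by (rule r1.rotate)
  consider "x = z" | "y = x" | "z = y" | "x \<noteq> y" "y \<noteq> z" "x \<noteq> z" by metis
  then show ?thesis
  proof cases
    case 4
    consider "cx \<noteq> cy" "cx \<noteq> cz" | "cy \<noteq> cz" "cy \<noteq> cx" | "cz \<noteq> cx" "cz \<noteq> cy" | "cx = cy" "cy = cz"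
      using ternary_colour by metis
    then show ?thesis
      using 4 reducible_two_colours r1.reducible_two_colours r2.reducible_two_colours
        reducible_all_red reducible_all_blue
      by cases (metis colour.exhaust)+
  qed (use reducible_doubled r1.reducible_doubled r2.reducible_doubled in metis)+
qed

end

section \<open>A vertex of degree two or three, and the induction\<close>

context tight_limited
begin

text \<open>The degree sum is 4|V| - 4, so some degree is below 4. Deleting a vertex of degree below
  two from a tight graph would leave more than 2(|V| - 1) - 2 edges on the nonempty
  remainder.\<close>

lemma low_degree_vertex:
  assumes "2 \<le> card V"
  obtains v where "v \<in> V" "card (star E v) = 2 \<or> card (star E v) = 3"
proof -
  have two: "card {v \<in> V. v \<in> fst p} = 2" if p: "p \<in> E" for p
  proof -
    obtain a b where ab: "a \<in> V" "b \<in> V" "a \<noteq> b" "fst p = {a, b}"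
      using bspec[OF on[unfolded edges_on_def] p] by auto
    then have "{v \<in> V. v \<in> fst p} = {a, b}" by auto
    then show ?thesis using ab by simp
  qed
  have sum: "(\<Sum>v\<in>V. card (star E v)) = 2 * card E"
    unfolding star_def by (rule sum_multicount[OF finite_V finite_E]) (use two in simp)
  have "\<exists>v \<in> V. card (star E v) < 4"
  proof (rule ccontr)
    assume "\<not> ?thesis"
    then have "4 \<le> card (star E v)" if "v \<in> V" for v using that not_less by blast
    then have "card V * 4 \<le> (\<Sum>v\<in>V. card (star E v))" by (metis sum_bounded_below of_nat_id)
    then show False using sum card_E by linarith
  qed
  then obtain v where v: "v \<in> V" "card (star E v) < 4" by blast
  have "V - {v} \<noteq> {}" using card_remove[OF v(1)] assms by (metis One_nat_def add_0 card.empty not_less_eq_eq numeral_2_eq_2 order_refl)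
  then have "card (ind (rest E v) (V - {v})) + 2 \<le> 2 * card (V - {v})"
    by (intro ksparse_2D[OF ksparse_rest(1)]) (simp_all add: finite_V)
  moreover have "ind (rest E v) (V - {v}) = rest E v"
    using edges_on_subset[OF edges_on_rest[OF on]] unfolding ind_def by blast
  then have "card (ind (rest E v) (V - {v})) = card (rest E v)" by simp
  ultimately have "2 \<le> card (star E v)"
    using card_star_rest[OF finite_E, of v] card_remove[OF v(1)] card_E by linarith
  then show thesis using v by (intro that[of v]) linarith+
qed

lemma reducible:
  assumes "2 \<le> card V"
  shows "reducible V E"
proof -
  obtain v where v: "v \<in> V" "card (star E v) = 2 \<or> card (star E v) = 3"
    using low_degree_vertex[OF assms] .
  show ?thesis
  proof (cases "card (star E v) = 2")
    case True
    then show ?thesis using reducible_degree_two v(1) by blast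
  next
    case False
    then have d3: "card (star E v) = 3" using v(2) by simp
    then obtain a b c where abc: "star E v = {a, b, c}" using card_3_iff by metis
    then have "a \<in> star E v" "b \<in> star E v" "c \<in> star E v" by simp_all
    then obtain x cx y cy z cz where x: "a = ({x, v}, cx)" and y: "b = ({y, v}, cy)" and z: "c = ({z, v}, cz)"
      by (metis star_edge)
    interpret degree_three V E v x y z cx cy cz
      using v(1) d3 abc unfolding x y z by unfold_locales
    show ?thesis by (rule reducible_degree_three)
  qed
qed

end

lemma generated_if_tight_limited:
  "tight_limited V E \<Longrightarrow> generated_from_K1 \<lparr>verts = V, edges = E\<rparr>"
proof (induction "card V" arbitrary: V E rule: less_induct)
  case less
  interpret tight_limited V E by fact
  show ?case
  proof (cases "2 \<le> card V")
    case True
    then obtain V0 E0 where *: "tight_limited V0 E0" "card V0 < card V"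
      "permitted_move \<lparr>verts = V0, edges = E0\<rparr> \<lparr>verts = V, edges = E\<rparr>"
      using reducible unfolding reducible_def by metis
    then show ?thesis
      using less(1)[OF *(2,1)] unfolding generated_from_K1_def by (metis rtranclp.rtrancl_into_rtrancl)
  next
    case False
    moreover have "card V > 0" using finite_V nonempty by (simp add: card_gt_0_iff)
    ultimately have "card V = 1" "card E = 0" using card_E by linarith+
    then obtain u where "V = {u}" "E = {}" using finite_E card_1_singletonE by (metis card_0_eq)
    then show ?thesis unfolding generated_from_K1_def K1_def by blast
  qed
qed

lemma tight_limited_if_generated:
  assumes "generated_from_K1 G"
  shows "tight_limited (verts G) (edges G)"
proof -
  obtain u where "permitted_move\<^sup>*\<^sup>* (K1 u) G" using assms unfolding generated_from_K1_def by blast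
  then show ?thesis
  proof induction
    case base
    show ?case unfolding K1_def using tight_limited_K1 by simp
  next
    case (step G G')
    then show ?case using permitted_move_tight_limited by blast
  qed
qed

theorem lemma4p2:
  fixes G :: "'a bcgraph"
  assumes "bicoloured_multigraph G"
  shows "tight 2 G \<and> limited G \<longleftrightarrow> generated_from_K1 G"
proof -
  have "tight 2 G \<and> limited G \<longleftrightarrow> tight_limited (verts G) (edges G)"
    using tight_limited_iff[of G] assms by blast
  moreover have "generated_from_K1 G" if "tight_limited (verts G) (edges G)"
    using generated_if_tight_limited[OF that] by (cases G) simp
  ultimately show ?thesis using tight_limited_if_generated by blast
qed

end
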